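(* Let $\mathbb{K}$ be a field, $R=\mathbb{K}[x_1,\dots,x_n]$, $\mathbf{a}\in\mathbb{N}^n$, and let $I$ be an $\mathbf{a}$-determined strongly stable ideal in $R$ generated in degree $d$, with minimal monomial generators $G(I)=\{f_1,\dots,f_\nu\}$. For each $k\in\{1,\dots,\nu\}$ write $r_k=|\operatorname{supp}_1(f_k)|$. Then for all $i$ $$\beta_i\left(\widehat{I}^{[\mathbf{a}]}\right)=\sum_{k=1}^{\nu}\binom{r_k}{i}.$$ In particular, $\operatorname{pd}(\widehat{I}^{[\mathbf{a}]})=\max\{r_1,r_2,\dots,r_\nu\}$.
   Context: $G(I)$ is the minimal set of monomial generators of $I$; generated in degree $d$ means all of them have degree $d$. For $\mathbf{a}\in\mathbb{N}^n$ put $\mathbf{x}^{\mathbf{a}}=\prod_k x_k^{\mathbf{a}(k)}$. $I$ is $\mathbf{a}$-determined if every $f\in G(I)$ divides $\mathbf{x}^{\mathbf{a}}$; then the $\mathbf{a}$-dual $\widehat{I}^{[\mathbf{a}]}$ is the monomial ideal whose minimal monomial generators are the $\mathbf{x}^{\mathbf{a}}/f$, $f\in G(I)$. $I$ is strongly stable if for each monomial $m\in I$, each $x_i$ dividing $m$ and each $j<i$, $mx_j/x_i\in I$. For a monomial $m$, $\operatorname{supp}_1(m)=\{i\ge2\mid x_i\text{ divides }m\}$. $\beta_i(M)$ denotes the $i$-th total Betti number of the $R$-module $M$ (rank of the $i$-th module in the minimal graded free resolution of $M$), and $\operatorname{pd}$ denotes projective dimension over $R$. *)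

theory Defs
  imports
    "HOL-Algebra.Ideal"
    "HOL-Algebra.Module"
    "HOL-Library.Poly_Mapping"
    "HOL-Library.Extended_Nat"
begin

section \<open>Modules, free modules and resolutions\<close>

definition lin_maps :: "('r, 'q) ring_scheme \<Rightarrow> ('r, 'a, 'p) module_scheme
    \<Rightarrow> ('r, 'b, 's) module_scheme \<Rightarrow> ('a \<Rightarrow> 'b) set"
  where "lin_maps R M N = {h. h \<in> carrier M \<rightarrow> carrier N \<and>
    (\<forall>x\<in>carrier M. \<forall>y\<in>carrier M. h (x \<oplus>\<^bsub>M\<^esub> y) = h x \<oplus>\<^bsub>N\<^esub> h y) \<and>
    (\<forall>r\<in>carrier R. \<forall>x\<in>carrier M. h (r \<odot>\<^bsub>M\<^esub> x) = r \<odot>\<^bsub>N\<^esub> h x)}"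

text \<open>A module record extends a ring record; its multiplication and unit play no role in the
  theory of modules and are left unspecified.\<close>

definition free_module :: "('r, 'q) ring_scheme \<Rightarrow> 'x set \<Rightarrow> ('r, 'x \<Rightarrow> 'r) module"
  where "free_module R X =
    \<lparr>carrier = {f. range f \<subseteq> carrier R \<and> finite {x. f x \<noteq> \<zero>\<^bsub>R\<^esub>} \<and> {x. f x \<noteq> \<zero>\<^bsub>R\<^esub>} \<subseteq> X},
     mult = undefined, one = undefined,
     zero = (\<lambda>_. \<zero>\<^bsub>R\<^esub>), add = (\<lambda>f g x. f x \<oplus>\<^bsub>R\<^esub> g x),
     smult = (\<lambda>r f x. r \<otimes>\<^bsub>R\<^esub> f x)\<rparr>"

text \<open>Projective means: a direct summand of a free module. It is no restriction to take the basis
  inside the type of the elements of \<open>P\<close>: if \<open>P\<close> is a summand of any free module, then the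
  canonical surjection onto \<open>P\<close> from the free module on the set \<open>carrier P\<close> splits.\<close>

definition projective_module :: "('r, 'q) ring_scheme \<Rightarrow> ('r, 'c) module \<Rightarrow> bool"
  where "projective_module R P \<longleftrightarrow> Module.module R P \<and>
    (\<exists>(X :: 'c set) s p. s \<in> lin_maps R P (free_module R X) \<and> p \<in> lin_maps R (free_module R X) P \<and>
       (\<forall>x\<in>carrier P. p (s x) = x))"

text \<open>\<open>resolution R M P d \<epsilon>\<close>: the sequence
  \<open>\<dots> \<rightarrow> P 2 \<rightarrow> P 1 \<rightarrow> P 0 \<rightarrow> M \<rightarrow> 0\<close>
  with maps \<open>d i : P (i + 1) \<rightarrow> P i\<close> and \<open>\<epsilon> : P 0 \<rightarrow> M\<close> is an exact sequence of modules.\<close>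

definition resolution :: "('r, 'q) ring_scheme \<Rightarrow> ('r, 'm) module \<Rightarrow> (nat \<Rightarrow> ('r, 'c) module)
    \<Rightarrow> (nat \<Rightarrow> 'c \<Rightarrow> 'c) \<Rightarrow> ('c \<Rightarrow> 'm) \<Rightarrow> bool"
  where "resolution R M P d \<epsilon> \<longleftrightarrow>
    Module.module R M \<and> (\<forall>i. Module.module R (P i)) \<and>
    (\<forall>i. d i \<in> lin_maps R (P (Suc i)) (P i)) \<and> \<epsilon> \<in> lin_maps R (P 0) M \<and>
    \<epsilon> ` carrier (P 0) = carrier M \<and>
    d 0 ` carrier (P 1) = {x \<in> carrier (P 0). \<epsilon> x = \<zero>\<^bsub>M\<^esub>} \<and>
    (\<forall>i. d (Suc i) ` carrier (P (Suc (Suc i))) = {x \<in> carrier (P (Suc i)). d i x = \<zero>\<^bsub>P i\<^esub>})"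

text \<open>Projective dimension: the infimum of the lengths of projective resolutions. The modules in
  the resolutions have elements of type \<open>('r \<times> 'm) list\<close>. This does not change the infimum:
  up to isomorphism this type carries every module whose cardinality is at most that of the
  lists over \<open>'r \<times> 'm\<close>, hence \<open>M\<close> itself, the iterated free covers of \<open>M\<close> and all
  their syzygies.\<close>

definition proj_dim :: "('r, 'q) ring_scheme \<Rightarrow> ('r, 'm) module \<Rightarrow> enat"
  where "proj_dim R M = Inf {enat l | l. \<exists>(P :: nat \<Rightarrow> ('r, ('r \<times> 'm) list) module) d \<epsilon>.
    resolution R M P d \<epsilon> \<and> (\<forall>i. projective_module R (P i)) \<and>
    (\<forall>i>l. carrier (P i) = {\<zero>\<^bsub>P i\<^esub>})}"


section \<open>The polynomial ring\<close>

text \<open>The variables \<open>x\<^sub>1, \<dots>, x\<^sub>n\<close> are indexed by a finite linearly ordered type \<open>'n\<close> with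
  \<open>n = CARD('n)\<close>; the index \<open>1\<close> is the least element of \<open>'n\<close>. Exponent vectors, and with them
  the monomials, are the elements of \<open>'n \<Rightarrow>\<^sub>0 nat\<close>.\<close>

type_synonym ('n, 'k) mpoly = "('n \<Rightarrow>\<^sub>0 nat) \<Rightarrow>\<^sub>0 'k"

definition xpow :: "('n \<Rightarrow>\<^sub>0 nat) \<Rightarrow> ('n, 'k :: field) mpoly"
  where "xpow a = Poly_Mapping.single a 1"

definition var :: "'n \<Rightarrow> ('n, 'k :: field) mpoly"
  where "var i = xpow (Poly_Mapping.single i 1)"

definition mon_dvd :: "('n \<Rightarrow>\<^sub>0 nat) \<Rightarrow> ('n \<Rightarrow>\<^sub>0 nat) \<Rightarrow> bool"
  where "mon_dvd f g \<longleftrightarrow> (\<exists>h. g = f + h)"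

definition mon_deg :: "('n :: finite \<Rightarrow>\<^sub>0 nat) \<Rightarrow> nat"
  where "mon_deg m = (\<Sum>i\<in>UNIV. Poly_Mapping.lookup m i)"

definition poly_ring :: "('n, 'k :: field) mpoly ring"
  where "poly_ring = \<lparr>carrier = UNIV, mult = (*), one = 1, zero = 0, add = (+)\<rparr>"

definition ideal_module :: "('n, 'k :: field) mpoly set \<Rightarrow> (('n, 'k) mpoly, ('n, 'k) mpoly) module"
  where "ideal_module I =
    \<lparr>carrier = I, mult = undefined, one = undefined, zero = 0, add = (+), smult = (*)\<rparr>"

definition homogeneous_of :: "int \<Rightarrow> ('n :: finite, 'k :: field) mpoly set"
  where "homogeneous_of t = {p. \<forall>m\<in>Poly_Mapping.keys p. int (mon_deg m) = t}"

definition irrelevant_ideal :: "('n, 'k :: field) mpoly set"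
  where "irrelevant_ideal = Idl\<^bsub>poly_ring\<^esub> (range var)"


section \<open>Minimal graded free resolutions and Betti numbers\<close>

text \<open>The graded free module \<open>R(-s\<^sub>0) \<oplus> \<dots> \<oplus> R(-s\<^sub>b\<^sub>-\<^sub>1)\<close> has underlying module
  \<open>free_module R {..<b}\<close>; its component of degree \<open>t\<close> is the following set.\<close>

definition free_component ::
    "nat \<Rightarrow> (nat \<Rightarrow> int) \<Rightarrow> int \<Rightarrow> (nat \<Rightarrow> ('n :: finite, 'k :: field) mpoly) set"
  where "free_component b s t =
    {v \<in> carrier (free_module poly_ring {..<b}). \<forall>j<b. v j \<in> homogeneous_of (t - s j)}"

text \<open>A graded module is given by a module \<open>M\<close> and its homogeneous components \<open>H t\<close>.
  The maps of the resolution preserve degrees, and minimality says that \<open>d i\<close> maps into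
  the product of the irrelevant ideal with the next free module.\<close>

definition minimal_graded_free_resolution ::
    "(('n :: finite, 'k :: field) mpoly, 'm) module \<Rightarrow> (int \<Rightarrow> 'm set) \<Rightarrow>
     (nat \<Rightarrow> nat) \<Rightarrow> (nat \<Rightarrow> nat \<Rightarrow> int) \<Rightarrow>
     (nat \<Rightarrow> (nat \<Rightarrow> ('n, 'k) mpoly) \<Rightarrow> (nat \<Rightarrow> ('n, 'k) mpoly)) \<Rightarrow>
     ((nat \<Rightarrow> ('n, 'k) mpoly) \<Rightarrow> 'm) \<Rightarrow> bool"
  where "minimal_graded_free_resolution M H b s d \<epsilon> \<longleftrightarrow>
    resolution poly_ring M (\<lambda>i. free_module poly_ring {..<b i}) d \<epsilon> \<and>
    (\<forall>i t. d i ` free_component (b (Suc i)) (s (Suc i)) t \<subseteq> free_component (b i) (s i) t) \<and>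
    (\<forall>t. \<epsilon> ` free_component (b 0) (s 0) t \<subseteq> H t) \<and>
    (\<forall>i. \<forall>v \<in> carrier (free_module poly_ring {..<b (Suc i)}). \<forall>j<b i. d i v j \<in> irrelevant_ideal)"

definition betti ::
    "(('n :: finite, 'k :: field) mpoly, 'm) module \<Rightarrow> (int \<Rightarrow> 'm set) \<Rightarrow> nat \<Rightarrow> nat"
  where "betti M H i =
    (THE r. \<exists>b s d \<epsilon>. minimal_graded_free_resolution M H b s d \<epsilon> \<and> b i = r)"

definition ideal_betti :: "('n :: finite, 'k :: field) mpoly set \<Rightarrow> nat \<Rightarrow> nat"
  where "ideal_betti I = betti (ideal_module I) (\<lambda>t. I \<inter> homogeneous_of t)"


section \<open>Monomial ideals\<close>

text \<open>The least set in \<open>min_gens\<close> is taken with respect to inclusion; it exists for every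
  monomial ideal (see below). Quotients of monomials are differences of exponent vectors. The
  subtraction is truncated, but it is only applied where the divisibility holds:
  \<open>dual_ideal a I\<close> is meant for \<open>I\<close> with \<open>determined_by a I\<close>.\<close>

definition monomial_ideal :: "('n, 'k :: field) mpoly set \<Rightarrow> bool"
  where "monomial_ideal I \<longleftrightarrow> (\<exists>S. I = Idl\<^bsub>poly_ring\<^esub> (xpow ` S))"

definition min_gens :: "('n, 'k :: field) mpoly set \<Rightarrow> ('n \<Rightarrow>\<^sub>0 nat) set"
  where "min_gens I = (LEAST S. Idl\<^bsub>poly_ring\<^esub> (xpow ` S) = I)"

definition generated_in_degree :: "nat \<Rightarrow> ('n :: finite, 'k :: field) mpoly set \<Rightarrow> bool"
  where "generated_in_degree d I \<longleftrightarrow> (\<forall>f\<in>min_gens I. mon_deg f = d)"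

definition determined_by :: "('n \<Rightarrow>\<^sub>0 nat) \<Rightarrow> ('n, 'k :: field) mpoly set \<Rightarrow> bool"
  where "determined_by a I \<longleftrightarrow> (\<forall>f\<in>min_gens I. mon_dvd f a)"

definition dual_ideal :: "('n \<Rightarrow>\<^sub>0 nat) \<Rightarrow> ('n, 'k :: field) mpoly set \<Rightarrow> ('n, 'k) mpoly set"
  where "dual_ideal a I = Idl\<^bsub>poly_ring\<^esub> (xpow ` {a - f | f. f \<in> min_gens I})"

definition strongly_stable :: "('n :: linorder, 'k :: field) mpoly set \<Rightarrow> bool"
  where "strongly_stable I \<longleftrightarrow> (\<forall>m i j. xpow m \<in> I \<longrightarrow> mon_dvd (Poly_Mapping.single i 1) m \<longrightarrow> j < i \<longrightarrow>
    xpow (m + Poly_Mapping.single j 1 - Poly_Mapping.single i 1) \<in> I)"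

definition supp1 :: "('n :: {finite, linorder} \<Rightarrow>\<^sub>0 nat) \<Rightarrow> 'n set"
  where "supp1 m = {i. i > Min UNIV \<and> mon_dvd (Poly_Mapping.single i 1) m}"


subsection \<open>The minimal generators of the dual\<close>

lemma cring_poly_ring: "cring (poly_ring :: ('n, 'k :: field) mpoly ring)"
proof (rule cringI)
  show "abelian_group (poly_ring :: ('n, 'k) mpoly ring)"
  proof (rule abelian_groupI)
    fix x :: "('n, 'k) mpoly"
    show "\<exists>y\<in>carrier poly_ring. y \<oplus>\<^bsub>poly_ring\<^esub> x = \<zero>\<^bsub>poly_ring\<^esub>"
      by (rule bexI[of _ "- x"]) (simp_all add: poly_ring_def)
  qed (simp_all add: poly_ring_def ac_simps)
  show "comm_monoid (poly_ring :: ('n, 'k) mpoly ring)"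
    by (rule comm_monoidI) (simp_all add: poly_ring_def ac_simps)
qed (simp_all add: poly_ring_def algebra_simps)

lemma keys_mult_dvd:
  fixes p q :: "('n, 'k :: field) mpoly"
  assumes "\<And>m. m \<in> Poly_Mapping.keys p \<Longrightarrow> \<exists>t\<in>T. mon_dvd t m" and "m \<in> Poly_Mapping.keys (p * q)"
  shows "\<exists>t\<in>T. mon_dvd t m"
proof -
  obtain u v where u: "u \<in> Poly_Mapping.keys p" "m = u + v"
    using keys_mult[of p q] assms(2) by blast
  then obtain t h where "t \<in> T" "u = t + h"
    using assms(1) unfolding mon_dvd_def by blast
  with u show ?thesis by (auto simp: mon_dvd_def add.assoc)
qed

lemma xpow_mem_Idl_iff:
  fixes T :: "('n \<Rightarrow>\<^sub>0 nat) set"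
  shows "(xpow m :: ('n, 'k :: field) mpoly) \<in> Idl\<^bsub>poly_ring\<^esub> (xpow ` T) \<longleftrightarrow> (\<exists>t\<in>T. mon_dvd t m)"
proof
  interpret R: cring "poly_ring :: ('n, 'k) mpoly ring" by (rule cring_poly_ring)
  let ?J = "{p :: ('n, 'k) mpoly. \<forall>m\<in>Poly_Mapping.keys p. \<exists>t\<in>T. mon_dvd t m}"
  have "ideal ?J poly_ring"
  proof (rule idealI)
    show "ring (poly_ring :: ('n, 'k) mpoly ring)" by (rule R.ring_axioms)
    show "subgroup ?J (add_monoid poly_ring)"
    proof (rule R.add.subgroupI)
      fix p q :: "('n, 'k) mpoly" assume pq: "p \<in> ?J" "q \<in> ?J"
      then show "p \<oplus>\<^bsub>poly_ring\<^esub> q \<in> ?J"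
        using keys_add[of p q] by (auto simp: poly_ring_def)
      have "- p \<oplus>\<^bsub>poly_ring\<^esub> p = \<zero>\<^bsub>poly_ring\<^esub>" by (simp add: poly_ring_def)
      then have "\<ominus>\<^bsub>poly_ring\<^esub> p = - p"
        by (rule R.minus_equality) (simp_all add: poly_ring_def)
      then show "\<ominus>\<^bsub>poly_ring\<^esub> p \<in> ?J"
        using pq by simp
    next
      show "?J \<noteq> {}"
        by (auto intro: exI[of _ 0])
    qed (simp add: poly_ring_def)
  next
    fix p q :: "('n, 'k) mpoly" assume "p \<in> ?J"
    then have "p * q \<in> ?J" using keys_mult_dvd[of p T _ q] by blast
    then show "q \<otimes>\<^bsub>poly_ring\<^esub> p \<in> ?J" "p \<otimes>\<^bsub>poly_ring\<^esub> q \<in> ?J"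
      by (simp_all add: poly_ring_def mult.commute)
  qed
  moreover have "xpow ` T \<subseteq> ?J"
    by (auto simp: xpow_def mon_dvd_def intro!: bexI exI[of _ 0])
  ultimately have sub: "Idl\<^bsub>poly_ring\<^esub> (xpow ` T) \<subseteq> ?J"
    by (rule R.genideal_minimal)
  show "\<exists>t\<in>T. mon_dvd t m" if "(xpow m :: ('n, 'k) mpoly) \<in> Idl\<^bsub>poly_ring\<^esub> (xpow ` T)"
    using that sub by (auto simp: xpow_def)
  show "(xpow m :: ('n, 'k) mpoly) \<in> Idl\<^bsub>poly_ring\<^esub> (xpow ` T)" if "\<exists>t\<in>T. mon_dvd t m"
  proof -
    obtain t h where th: "t \<in> T" "m = t + h" using \<open>\<exists>t\<in>T. mon_dvd t m\<close> by (auto simp: mon_dvd_def)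
    have id: "ideal (Idl\<^bsub>poly_ring\<^esub> (xpow ` T)) (poly_ring :: ('n, 'k) mpoly ring)"
      by (rule R.genideal_ideal) (simp add: poly_ring_def)
    have "xpow t \<in> Idl\<^bsub>poly_ring\<^esub> (xpow ` T :: ('n, 'k) mpoly set)"
      using R.genideal_self[of "xpow ` T"] th by (auto simp: poly_ring_def)
    then have "xpow t \<otimes>\<^bsub>poly_ring\<^esub> xpow h \<in> Idl\<^bsub>poly_ring\<^esub> (xpow ` T :: ('n, 'k) mpoly set)"
      by (rule ideal.I_r_closed[OF id]) (simp add: poly_ring_def)
    moreover have "xpow t \<otimes>\<^bsub>poly_ring\<^esub> xpow h = (xpow m :: ('n, 'k) mpoly)"
      using th by (simp add: poly_ring_def xpow_def mult_single)
    ultimately show ?thesis by simp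
  qed
qed

lemma mon_dvd_antisym:
  assumes "mon_dvd f g" and "mon_dvd g f"
  shows "f = g"
proof (rule poly_mapping_eqI)
  fix i
  have "Poly_Mapping.lookup f i \<le> Poly_Mapping.lookup g i" "Poly_Mapping.lookup g i \<le> Poly_Mapping.lookup f i"
    using assms by (metis lookup_add le_add1 mon_dvd_def)+
  then show "Poly_Mapping.lookup f i = Poly_Mapping.lookup g i" by simp
qed

lemma mon_dvd_trans: "mon_dvd f g \<Longrightarrow> mon_dvd g h \<Longrightarrow> mon_dvd f h"
  unfolding mon_dvd_def by (metis add.assoc)

lemma min_gens_antichain:
  assumes anti: "\<And>f g. f \<in> S \<Longrightarrow> g \<in> S \<Longrightarrow> mon_dvd f g \<Longrightarrow> f = g"
  shows "min_gens (Idl\<^bsub>poly_ring\<^esub> (xpow ` S) :: ('n, 'k :: field) mpoly set) = S"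
  unfolding min_gens_def
proof (rule Least_equality)
  fix T
  assume T: "Idl\<^bsub>poly_ring\<^esub> (xpow ` T) = (Idl\<^bsub>poly_ring\<^esub> (xpow ` S) :: ('n, 'k) mpoly set)"
  have eq: "(\<exists>t\<in>T. mon_dvd t m) \<longleftrightarrow> (\<exists>t\<in>S. mon_dvd t m)" for m
    using xpow_mem_Idl_iff[of m T, where 'k = 'k] xpow_mem_Idl_iff[of m S, where 'k = 'k] T by simp
  have refl: "mon_dvd f f" for f :: "'n \<Rightarrow>\<^sub>0 nat" unfolding mon_dvd_def by (rule exI[of _ 0]) simp
  show "S \<le> T"
  proof
    fix f assume f: "f \<in> S"
    then obtain t where t: "t \<in> T" "mon_dvd t f" using eq refl by blast
    then obtain g where g: "g \<in> S" "mon_dvd g t" using eq refl by blast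
    then have "g = f" using anti f t mon_dvd_trans by blast
    then show "f \<in> T" using mon_dvd_antisym g t by blast
  qed
qed simp

lemma ex_min_mon_dvd:
  fixes f :: "'n :: finite \<Rightarrow>\<^sub>0 nat"
  assumes "f \<in> S"
  shows "\<exists>g\<in>S. mon_dvd g f \<and> (\<forall>h\<in>S. mon_dvd h g \<longrightarrow> h = g)"
  using assms
proof (induction "mon_deg f" arbitrary: f rule: less_induct)
  case less
  show ?case
  proof (cases "\<forall>h\<in>S. mon_dvd h f \<longrightarrow> h = f")
    case True
    moreover have "mon_dvd f f" unfolding mon_dvd_def by (rule exI[of _ 0]) simp
    ultimately show ?thesis using less.prems by blast
  next
    case False
    then obtain h u where h: "h \<in> S" "h \<noteq> f" and u: "f = h + u" by (auto simp: mon_dvd_def)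
    then have "u \<noteq> 0" by auto
    then obtain i where "Poly_Mapping.lookup u i \<noteq> 0" by (metis poly_mapping_eqI lookup_zero)
    then have "mon_deg u > 0" unfolding mon_deg_def by (simp add: sum_pos2)
    then have "mon_deg h < mon_deg f"
      using u by (simp add: mon_deg_def lookup_add sum.distrib)
    then obtain g where "g \<in> S" "mon_dvd g h" "\<forall>h\<in>S. mon_dvd h g \<longrightarrow> h = g"
      using less.hyps h by blast
    moreover have "mon_dvd h f" using u by (auto simp: mon_dvd_def)
    ultimately show ?thesis using mon_dvd_trans by blast
  qed
qed

lemma min_gens_monomial_ideal:
  fixes I :: "('n :: finite, 'k :: field) mpoly set"
  assumes "monomial_ideal I"
  shows "Idl\<^bsub>poly_ring\<^esub> (xpow ` min_gens I) = I"
    and "\<And>f g. f \<in> min_gens I \<Longrightarrow> g \<in> min_gens I \<Longrightarrow> mon_dvd f g \<Longrightarrow> f = g"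
proof -
  interpret R: cring "poly_ring :: ('n, 'k) mpoly ring" by (rule cring_poly_ring)
  obtain S where I: "I = Idl\<^bsub>poly_ring\<^esub> (xpow ` S)" using assms unfolding monomial_ideal_def by blast
  define T where "T = {g \<in> S. \<forall>h\<in>S. mon_dvd h g \<longrightarrow> h = g}"
  have anti: "\<And>f g. f \<in> T \<Longrightarrow> g \<in> T \<Longrightarrow> mon_dvd f g \<Longrightarrow> f = g" by (auto simp: T_def)
  have "xpow ` S \<subseteq> (Idl\<^bsub>poly_ring\<^esub> (xpow ` T) :: ('n, 'k) mpoly set)"
  proof clarify
    fix m assume "m \<in> S"
    then have "\<exists>t\<in>T. mon_dvd t m" using ex_min_mon_dvd[of m S] by (auto simp: T_def)
    then show "(xpow m :: ('n, 'k) mpoly) \<in> Idl\<^bsub>poly_ring\<^esub> (xpow ` T)"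
      by (simp add: xpow_mem_Idl_iff)
  qed
  then have "I \<subseteq> Idl\<^bsub>poly_ring\<^esub> (xpow ` T)"
    unfolding I by (intro R.genideal_minimal R.genideal_ideal) (simp_all add: poly_ring_def)
  moreover have "Idl\<^bsub>poly_ring\<^esub> (xpow ` T) \<subseteq> I"
    unfolding I by (rule R.subset_Idl_subset) (auto simp: poly_ring_def T_def)
  ultimately have IT: "I = Idl\<^bsub>poly_ring\<^esub> (xpow ` T)" by blast
  have eq: "min_gens I = T" unfolding IT by (rule min_gens_antichain) (rule anti)
  show "Idl\<^bsub>poly_ring\<^esub> (xpow ` min_gens I) = I" using eq IT by simp
  show "\<And>f g. f \<in> min_gens I \<Longrightarrow> g \<in> min_gens I \<Longrightarrow> mon_dvd f g \<Longrightarrow> f = g"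
    using anti eq by blast
qed

lemma min_gens_dual_ideal:
  fixes I :: "('n :: finite, 'k :: field) mpoly set"
  assumes "monomial_ideal I" and "determined_by a I"
  shows "min_gens (dual_ideal a I) = {a - f | f. f \<in> min_gens I}"
  unfolding dual_ideal_def
proof (rule min_gens_antichain)
  have inv: "f + (a - f) = a" if "f \<in> min_gens I" for f
    using assms(2) that by (auto simp: determined_by_def mon_dvd_def)
  fix u v assume "u \<in> {a - f | f. f \<in> min_gens I}" "v \<in> {a - f | f. f \<in> min_gens I}" "mon_dvd u v"
  then obtain f g h where fg: "f \<in> min_gens I" "g \<in> min_gens I" "u = a - f" "v = a - g" "a - g = a - f + h"
    by (auto simp: mon_dvd_def)
  have "f + (a - f) = g + (a - f + h)" using inv fg by metis
  then have "f = g + h" by (metis add.assoc add.commute add_right_cancel)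
  then have "mon_dvd g f" unfolding mon_dvd_def by blast
  then have "g = f" using min_gens_monomial_ideal(2)[OF assms(1)] fg(1,2) by blast
  then show "u = v" using fg by simp
qed

end

theory Submission
  imports Defs "HOL-Library.Function_Algebras"
begin

text \<open>Adjoining a generator \<open>u\<close> to a monomial ideal \<open>I\<close> replaces a free resolution of \<open>R/I\<close> by the
  mapping cone over a lift of multiplication by \<open>u\<close> from a resolution of \<open>R/(I : u)\<close>. If \<open>I\<close> and
  \<open>u\<close> live in degree \<open>D\<close> and \<open>I : u\<close> in degree 1, and both resolutions are linear, then so is the
  cone; hence it is minimal and ranks add up. Starting from the zero ideal this
  yields the Koszul complex of a set of variables, because \<open>(x\<^sub>i | i \<in> S) : x\<^sub>t\<close> is
  \<open>(x\<^sub>i | i \<in> S)\<close> for \<open>t \<notin> S\<close>. It also yields the resolution of the dual: add the generators \<open>x\<^sup>a/f\<close>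
  in lexicographically decreasing order of \<open>f\<close>. By strong stability the colon ideal at \<open>f\<close> is then
  generated by the \<open>x\<^sub>i\<close> with \<open>i \<in> supp\<^sub>1 f\<close>, which contributes \<open>r choose i\<close> with \<open>r = |supp\<^sub>1 f|\<close>.

  For a minimal resolution \<open>F\<close> and any projective resolution \<open>P\<close> of the same module, the composite
  of lifts \<open>F \<rightarrow> P \<rightarrow> F\<close> is homotopic to the identity, hence the identity modulo the irrelevant ideal.
  This gives both the uniqueness of the ranks and the lower bound for the projective dimension.\<close>

section \<open>Row vectors and matrices\<close>

text \<open>Vectors of length \<open>n\<close> are extended by zero, so that all lengths share one
  type and this set is the carrier of \<open>free_module poly_ring {..<n}\<close>.\<close>

definition vecs :: "nat \<Rightarrow> (nat \<Rightarrow> 'r :: zero) set"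
  where "vecs n = {v. \<forall>j\<ge>n. v j = 0}"

definition unit_vec :: "'x \<Rightarrow> 'x \<Rightarrow> 'r :: zero_neq_one"
  where "unit_vec j = (\<lambda>l. if l = j then 1 else 0)"

text \<open>The matrix \<open>A\<close> is given by its rows, and \<open>lin m A v\<close> is the row vector \<open>v A\<close>.\<close>

definition lin :: "nat \<Rightarrow> (nat \<Rightarrow> nat \<Rightarrow> 'r :: comm_ring_1) \<Rightarrow> (nat \<Rightarrow> 'r) \<Rightarrow> nat \<Rightarrow> 'r"
  where "lin m A v = (\<lambda>l. \<Sum>j<m. v j * A j l)"

text \<open>The entry type is arbitrary: with scalars as entries vectors are concatenated, with rows
  as entries matrices are stacked.\<close>

definition append_vec :: "nat \<Rightarrow> (nat \<Rightarrow> 'a) \<Rightarrow> (nat \<Rightarrow> 'a) \<Rightarrow> nat \<Rightarrow> 'a"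
  where "append_vec m v w = (\<lambda>l. if l < m then v l else w (l - m))"

lemma vecs_closed:
  fixes v w :: "nat \<Rightarrow> 'r :: comm_ring_1"
  assumes "v \<in> vecs n" "w \<in> vecs n"
  shows "v + w \<in> vecs n" "v - w \<in> vecs n" "- v \<in> vecs n" "(\<lambda>l. r * v l) \<in> vecs n"
  using assms by (auto simp: vecs_def)

lemma zero_in_vecs [simp]: "0 \<in> vecs n"
  by (simp add: vecs_def)

lemma unit_vec_in_vecs: "j < n \<Longrightarrow> unit_vec j \<in> vecs n"
  by (auto simp: vecs_def unit_vec_def)

lemma lin_unit_vec: "j < m \<Longrightarrow> lin m A (unit_vec j) = A j"
  by (simp add: lin_def unit_vec_def if_distrib[of "\<lambda>x. x * _"] sum.delta' cong: if_cong)

lemma lin_add: "lin m A (v + w) = lin m A v + lin m A w"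
  by (simp add: lin_def fun_eq_iff algebra_simps sum.distrib)

lemma lin_uminus: "lin m A (- v) = - lin m A v"
  by (simp add: lin_def fun_eq_iff sum_negf)

lemma lin_diff: "lin m A (v - w) = lin m A v - lin m A w"
  using lin_add[of m A v "- w"] by (simp add: lin_uminus)

lemma lin_zero [simp]: "lin m A 0 = 0"
  by (simp add: lin_def fun_eq_iff)

lemma lin_smult: "lin m A (\<lambda>l. r * v l) = (\<lambda>l. r * lin m A v l)"
  by (simp add: lin_def sum_distrib_left algebra_simps)

lemma lin_uminus_matrix: "lin m (\<lambda>j. - A j) v = - lin m A v"
  by (simp add: lin_def fun_eq_iff sum_negf)

lemma lin_lin: "lin m A (lin k B v) = lin k (\<lambda>j. lin m A (B j)) v"
proof
  fix l
  show "lin m A (lin k B v) l = lin k (\<lambda>j. lin m A (B j)) v l"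
    unfolding lin_def sum_distrib_left sum_distrib_right
    by (subst sum.swap) (simp only: mult.assoc)
qed

lemma lin_cong: "(\<And>j. j < m \<Longrightarrow> A j = B j) \<Longrightarrow> lin m A v = lin m B v"
  by (simp add: lin_def)

lemma lin_in_vecs: "(\<And>j. j < m \<Longrightarrow> A j \<in> vecs n) \<Longrightarrow> lin m A v \<in> vecs n"
  by (auto simp: lin_def vecs_def intro!: sum.neutral)

lemma append_vec_in_vecs: "v \<in> vecs m \<Longrightarrow> w \<in> vecs k \<Longrightarrow> append_vec m v w \<in> vecs (m + k)"
  by (auto simp: append_vec_def vecs_def)

lemma in_vecs_add_cases:
  fixes x :: "nat \<Rightarrow> 'r :: comm_ring_1"
  assumes "x \<in> vecs (m + k)"
  obtains v w where "v \<in> vecs m" "w \<in> vecs k" "x = append_vec m v w"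
proof
  show "(\<lambda>l. if l < m then x l else 0) \<in> vecs m" "(\<lambda>l. x (l + m)) \<in> vecs k"
    using assms by (auto simp: vecs_def)
qed (auto simp: append_vec_def)

lemma append_vec_eq_zero_iff:
  fixes v w :: "nat \<Rightarrow> 'r :: comm_ring_1"
  assumes "v \<in> vecs m"
  shows "append_vec m v w = 0 \<longleftrightarrow> v = 0 \<and> w = 0"
proof
  assume eq: "append_vec m v w = 0"
  have "v l = 0" for l
    using fun_cong[OF eq, of l] assms by (cases "l < m") (auto simp: append_vec_def vecs_def)
  moreover have "w l = 0" for l
    using fun_cong[OF eq, of "l + m"] by (simp add: append_vec_def)
  ultimately show "v = 0 \<and> w = 0" by auto
qed (auto simp: append_vec_def)

lemma append_vec_zero: "v \<in> vecs m \<Longrightarrow> append_vec m v 0 = v"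
  by (auto simp: append_vec_def vecs_def fun_eq_iff)

lemma append_vec_add:
  fixes v w :: "nat \<Rightarrow> 'r :: comm_ring_1"
  shows "append_vec m v w + append_vec m v' w' = append_vec m (v + v') (w + w')"
  by (auto simp: append_vec_def)

lemma sum_lessThan_add: "(\<Sum>j<m + k. f j) = (\<Sum>j<m. f j) + (\<Sum>j<k. f (m + j :: nat))"
  by (induction k) (simp_all add: add.assoc)

lemma lin_append:
  "lin (m + k) (append_vec m A B) (append_vec m v w) = lin m A v + lin k B w"
  by (simp add: lin_def append_vec_def sum_lessThan_add fun_eq_iff)

lemma lin_append_rows:
  "lin k (\<lambda>j. append_vec m (T j) (B j)) w = append_vec m (lin k T w) (lin k B w)"
  by (auto simp: lin_def append_vec_def)

section \<open>Homogeneous polynomials\<close>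

lemma mon_deg_add: "mon_deg (m + m') = mon_deg m + mon_deg m'"
  by (simp add: mon_deg_def lookup_add sum.distrib)

lemma homogeneous_of_zero [simp]: "0 \<in> homogeneous_of t"
  by (simp add: homogeneous_of_def)

lemma homogeneous_of_add: "p \<in> homogeneous_of t \<Longrightarrow> q \<in> homogeneous_of t \<Longrightarrow> p + q \<in> homogeneous_of t"
  using keys_add[of p q] by (auto simp: homogeneous_of_def)

lemma keys_uminus_poly_mapping [simp]: "Poly_Mapping.keys (- p :: 'a \<Rightarrow>\<^sub>0 'b :: ab_group_add) = Poly_Mapping.keys p"
  by (auto simp: in_keys_iff)

lemma homogeneous_of_uminus: "p \<in> homogeneous_of t \<Longrightarrow> - p \<in> homogeneous_of t"
  by (simp add: homogeneous_of_def)

lemma homogeneous_of_mult: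
  assumes "p \<in> homogeneous_of s" "q \<in> homogeneous_of t"
  shows "p * q \<in> homogeneous_of (s + t)"
  using assms keys_mult[of p q] by (fastforce simp: homogeneous_of_def mon_deg_add)

lemma homogeneous_of_sum: "(\<And>j. j \<in> S \<Longrightarrow> f j \<in> homogeneous_of t) \<Longrightarrow> sum f S \<in> homogeneous_of t"
  by (induction S rule: infinite_finite_induct) (auto intro: homogeneous_of_add)

lemma homogeneous_of_lin:
  assumes "\<And>j. j < m \<Longrightarrow> v j \<in> homogeneous_of s" "\<And>j. j < m \<Longrightarrow> A j l \<in> homogeneous_of t"
  shows "lin m A v l \<in> homogeneous_of (s + t)"
  unfolding lin_def using assms by (auto intro!: homogeneous_of_sum homogeneous_of_mult)

definition homogeneous_part :: "int \<Rightarrow> ('n :: finite, 'k :: field) mpoly \<Rightarrow> ('n, 'k) mpoly"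
  where "homogeneous_part t p =
    Abs_poly_mapping (\<lambda>m. if int (mon_deg m) = t then Poly_Mapping.lookup p m else 0)"

lemma lookup_homogeneous_part:
  "Poly_Mapping.lookup (homogeneous_part t p) m =
    (if int (mon_deg m) = t then Poly_Mapping.lookup p m else 0)"
proof -
  have "finite {m. (if int (mon_deg m) = t then Poly_Mapping.lookup p m else 0) \<noteq> 0}"
    by (rule finite_subset[OF _ finite_keys[of p]]) (auto simp: in_keys_iff)
  then show ?thesis by (simp add: homogeneous_part_def)
qed

lemma homogeneous_part_in: "homogeneous_part t p \<in> homogeneous_of t"
  by (auto simp: homogeneous_of_def in_keys_iff lookup_homogeneous_part split: if_splits)

lemma homogeneous_part_add: "homogeneous_part t (p + q) = homogeneous_part t p + homogeneous_part t q"
  by (rule poly_mapping_eqI) (simp add: lookup_homogeneous_part lookup_add)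

lemma homogeneous_part_zero: "homogeneous_part t 0 = 0"
  by (rule poly_mapping_eqI) (simp add: lookup_homogeneous_part)

lemma homogeneous_part_sum: "homogeneous_part t (sum f S) = (\<Sum>j\<in>S. homogeneous_part t (f j))"
  by (induction S rule: infinite_finite_induct) (simp_all add: homogeneous_part_add homogeneous_part_zero)

lemma homogeneous_part_id: "p \<in> homogeneous_of t \<Longrightarrow> homogeneous_part t p = p"
  by (rule poly_mapping_eqI) (auto simp: lookup_homogeneous_part homogeneous_of_def in_keys_iff)

text \<open>What remains of \<open>p\<close> after removing its part of degree \<open>s\<close> has
  no term of degree \<open>s\<close>, so its product with the homogeneous \<open>q\<close> has no
  term of degree \<open>s + t\<close>.\<close>

lemma homogeneous_part_mult:
  assumes q: "q \<in> homogeneous_of t"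
  shows "homogeneous_part (s + t) (p * q) = homogeneous_part s p * q"
proof -
  define r where "r = p - homogeneous_part s p"
  have "int (mon_deg m) \<noteq> s" if "m \<in> Poly_Mapping.keys r" for m
    using that by (auto simp: r_def in_keys_iff lookup_minus lookup_homogeneous_part split: if_splits)
  then have "int (mon_deg m) \<noteq> s + t" if "m \<in> Poly_Mapping.keys (r * q)" for m
    using that q keys_mult[of r q] by (fastforce simp: homogeneous_of_def mon_deg_add)
  then have "homogeneous_part (s + t) (r * q) = 0"
    by (intro poly_mapping_eqI) (auto simp: lookup_homogeneous_part in_keys_iff)
  moreover have "p * q = homogeneous_part s p * q + r * q"
    by (simp add: r_def algebra_simps)
  moreover have "homogeneous_part s p * q \<in> homogeneous_of (s + t)"
    using homogeneous_part_in q by (rule homogeneous_of_mult)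
  ultimately show ?thesis
    by (simp add: homogeneous_part_add homogeneous_part_id)
qed

text \<open>All entries of \<open>A\<close> have degree \<open>s\<close>, so taking the parts of
  degree \<open>t\<close> of the coordinates of any preimage gives a preimage of the part of
  \<open>y\<close> of degree \<open>t + s\<close>, which is \<open>y\<close>. This keeps the lifts
  below linear.\<close>

lemma homogeneous_preimage:
  fixes A :: "nat \<Rightarrow> nat \<Rightarrow> ('n :: finite, 'k :: field) mpoly"
  assumes A: "\<And>j l. j < m \<Longrightarrow> A j l \<in> homogeneous_of s"
    and y: "\<And>l. y l \<in> homogeneous_of (t + s)" "y \<in> lin m A ` vecs m"
  shows "\<exists>w \<in> vecs m. (\<forall>j. w j \<in> homogeneous_of t) \<and> lin m A w = y"
proof -
  obtain v where v: "v \<in> vecs m" "y = lin m A v" using y by blast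
  have "lin m A (\<lambda>j. homogeneous_part t (v j)) l = y l" for l
  proof -
    have "y l = homogeneous_part (t + s) (y l)"
      using y(1) by (simp add: homogeneous_part_id)
    also have "\<dots> = (\<Sum>j<m. homogeneous_part (t + s) (v j * A j l))"
      by (simp only: v(2) lin_def homogeneous_part_sum)
    also have "\<dots> = (\<Sum>j<m. homogeneous_part t (v j) * A j l)"
      by (intro sum.cong refl homogeneous_part_mult A) simp
    finally show ?thesis by (simp add: lin_def)
  qed
  then have "lin m A (\<lambda>j. homogeneous_part t (v j)) = y" by auto
  moreover have "(\<lambda>j. homogeneous_part t (v j)) \<in> vecs m"
    using v by (auto simp: vecs_def homogeneous_part_zero)
  ultimately show ?thesis
    by (intro bexI[of _ "\<lambda>j. homogeneous_part t (v j)"]) (simp_all add: homogeneous_part_in)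
qed

section \<open>Linear resolutions and mapping cones\<close>

text \<open>A resolution of \<open>R/I\<close> rather than \<open>I\<close>: the module in position \<open>0\<close> is \<open>R\<close>, the column \<open>A 0\<close>
  lists generators of \<open>I\<close> of degree \<open>D\<close>, and \<open>g (Suc i)\<close> is the \<open>i\<close>-th rank for \<open>I\<close>. This makes
  the cone uniform in all positions. No degree shifts are recorded, since linearity forces them.\<close>

definition lin_res :: "('n :: finite, 'k :: field) mpoly set \<Rightarrow> int \<Rightarrow> (nat \<Rightarrow> nat) \<Rightarrow>
    (nat \<Rightarrow> nat \<Rightarrow> nat \<Rightarrow> ('n, 'k) mpoly) \<Rightarrow> bool"
  where "lin_res I D g A \<longleftrightarrow> g 0 = 1 \<and>
    (\<forall>i. \<forall>j<g (Suc i). A i j \<in> vecs (g i)) \<and>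
    (\<forall>i. \<forall>j<g (Suc i). \<forall>l. A i j l \<in> homogeneous_of (if i = 0 then D else 1)) \<and>
    lin (g 1) (A 0) ` vecs (g 1) = {v \<in> vecs 1. v 0 \<in> I} \<and>
    (\<forall>i. lin (g (Suc (Suc i))) (A (Suc i)) ` vecs (g (Suc (Suc i))) =
       {v \<in> vecs (g (Suc i)). lin (g (Suc i)) (A i) v = 0})"

text \<open>For the zero ideal the quotient is the free module R itself, concentrated in position
  \<open>0\<close>; the degree \<open>D\<close> is arbitrary because there are no
  generators.\<close>

lemma lin_res_zero: "lin_res ({0} :: ('n :: finite, 'k :: field) mpoly set) D (\<lambda>i. if i = 0 then 1 else 0) (\<lambda>_ _. 0)"
proof -
  have [simp]: "v = 0" if "v \<in> vecs 0" for v :: "nat \<Rightarrow> ('n, 'k) mpoly"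
    using that by (auto simp: vecs_def)
  have [simp]: "v = 0 \<longleftrightarrow> v 0 = 0" if "v \<in> vecs 1" for v :: "nat \<Rightarrow> ('n, 'k) mpoly"
    using that by (auto simp: vecs_def fun_eq_iff) (metis One_nat_def not_less less_Suc0)
  have [simp]: "lin m A v = 0" if "m = 0 \<or> A = (\<lambda>_. 0)" for m A and v :: "nat \<Rightarrow> ('n, 'k) mpoly"
    using that by (auto simp add: lin_def fun_eq_iff)
  show ?thesis by (auto simp: lin_res_def image_iff) (rule exI[of _ 0], simp)
qed

text \<open>\<open>\<tau>\<close> lifts multiplication by \<open>u\<close> from \<open>R/J\<close> to \<open>R/I\<close>; it anticommutes with the differentials,
  so that the cone needs no signs.\<close>

lemma lin_res_chain_map:
  fixes u :: "('n :: finite, 'k :: field) mpoly"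
  assumes G: "lin_res I D g A" and K: "lin_res J 1 h B"
    and u: "u \<in> homogeneous_of D" and J: "J = {p. p * u \<in> I}"
  shows "\<exists>\<tau>. \<tau> 0 = (\<lambda>j l. if l = 0 then u else 0) \<and>
    (\<forall>i j. \<tau> i j \<in> vecs (g i)) \<and> (\<forall>i j l. \<tau> i j l \<in> homogeneous_of (if i = 0 then D else 1)) \<and>
    (\<forall>i. \<forall>j<h (Suc i). lin (g (Suc i)) (A i) (\<tau> (Suc i) j) = - lin (h i) (\<tau> i) (B i j))"
proof -
  \<comment> \<open>Invariant of the recursive choice; its last clause guarantees that the next
    component of the lift exists.\<close>
  define P where "P i t \<longleftrightarrow> (i = 0 \<longrightarrow> t = (\<lambda>j l. if l = 0 then u else 0)) \<and> (\<forall>j. t j \<in> vecs (g i)) \<and>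
    (\<forall>j l. t j l \<in> homogeneous_of (if i = 0 then D else 1)) \<and>
    (\<forall>j<h (Suc i). lin (h i) t (B i j) \<in> lin (g (Suc i)) (A i) ` vecs (g (Suc i)))"
    for i :: nat and t :: "nat \<Rightarrow> nat \<Rightarrow> ('n, 'k) mpoly"
  have g0: "g 0 = 1" and h0: "h 0 = 1" using G K by (auto simp: lin_res_def)
  have AD: "A i j l \<in> homogeneous_of (if i = 0 then D else 1)" if "j < g (Suc i)" for i j l
    using G that by (simp add: lin_res_def)
  have B1: "B i j l \<in> homogeneous_of 1" if "j < h (Suc i)" for i j l
    using K that unfolding lin_res_def by (metis (full_types))
  have exA: "lin (g (Suc (Suc i))) (A (Suc i)) ` vecs (g (Suc (Suc i))) =
       {v \<in> vecs (g (Suc i)). lin (g (Suc i)) (A i) v = 0}" for i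
    using G by (simp add: lin_res_def)
  have BB: "lin (h (Suc i)) (B i) (B (Suc i) j) = 0" if "j < h (Suc (Suc i))" for i j
  proof -
    have "B (Suc i) j \<in> lin (h (Suc (Suc i))) (B (Suc i)) ` vecs (h (Suc (Suc i)))"
      using that by (metis image_eqI lin_unit_vec unit_vec_in_vecs)
    then show ?thesis using K by (simp add: lin_res_def)
  qed
  have "\<exists>f. \<forall>n. P n (f n) \<and> (\<forall>j<h (Suc n). lin (g (Suc n)) (A n) (f (Suc n) j) = - lin (h n) (f n) (B n j))"
  proof (rule dependent_nat_choice)
    \<comment> \<open>The only coordinate of \<open>B 0 j\<close> lies in \<open>J\<close>, so its
      product with \<open>u\<close> lies in \<open>I\<close>, the image of
      \<open>A 0\<close>.\<close>
    have "lin (h 0) (\<lambda>j l. if l = 0 then u else 0) (B 0 j) \<in> lin (g (Suc 0)) (A 0) ` vecs (g (Suc 0))"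
      if "j < h (Suc 0)" for j
    proof -
      have "B 0 j \<in> lin (h 1) (B 0) ` vecs (h 1)"
        using that by (metis One_nat_def image_eqI lin_unit_vec unit_vec_in_vecs)
      then have "B 0 j 0 \<in> J" using K by (simp add: lin_res_def)
      then have "lin (h 0) (\<lambda>j l. if l = 0 then u else 0) (B 0 j) \<in> {v \<in> vecs 1. v 0 \<in> I}"
        by (simp add: lin_def h0 J vecs_def)
      then show ?thesis using G by (simp add: lin_res_def)
    qed
    then show "\<exists>t. P 0 t"
      using u by (intro exI[of _ "\<lambda>j l. if l = 0 then u else 0"]) (auto simp: P_def g0 vecs_def)
  next
    fix t i assume P: "P i t"
    let ?y = "\<lambda>j. - lin (h i) t (B i j)"
    have "\<exists>w \<in> vecs (g (Suc i)). (\<forall>l. w l \<in> homogeneous_of 1) \<and> lin (g (Suc i)) (A i) w = ?y j"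
      if j: "j < h (Suc i)" for j
    proof (rule homogeneous_preimage)
      show "A i k l \<in> homogeneous_of (if i = 0 then D else 1)" if "k < g (Suc i)" for k l
        using that AD by blast
      \<comment> \<open>The entries of \<open>B i\<close> are linear and those of \<open>t\<close>
        have the degree of the entries of \<open>A i\<close>, so a preimage with linear entries can
        be found.\<close>
      have "lin (h i) t (B i j) l \<in> homogeneous_of (1 + (if i = 0 then D else 1))" for l
        using P B1[OF j] by (intro homogeneous_of_lin) (auto simp: P_def)
      then show "?y j l \<in> homogeneous_of (1 + (if i = 0 then D else 1))" for l
        by (simp add: homogeneous_of_uminus)
      have "lin (h i) t (B i j) \<in> lin (g (Suc i)) (A i) ` vecs (g (Suc i))"
        using P j by (simp add: P_def)
      then obtain v where "v \<in> vecs (g (Suc i))" "?y j = lin (g (Suc i)) (A i) (- v)"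
        by (auto simp: lin_uminus)
      then show "?y j \<in> lin (g (Suc i)) (A i) ` vecs (g (Suc i))"
        by (blast intro: vecs_closed)
    qed
    then obtain t0 where t0: "\<And>j. j < h (Suc i) \<Longrightarrow> t0 j \<in> vecs (g (Suc i)) \<and>
        (\<forall>l. t0 j l \<in> homogeneous_of 1) \<and> lin (g (Suc i)) (A i) (t0 j) = ?y j"
      by metis
    \<comment> \<open>Rows from \<open>h (Suc i)\<close> on are filled with zero, since
      \<open>P\<close> constrains the rows of every index.\<close>
    define t' where "t' j = (if j < h (Suc i) then t0 j else 0)" for j
    have t'1: "t' j \<in> vecs (g (Suc i))" "t' j l \<in> homogeneous_of 1" for j l
      using t0 by (auto simp: t'_def vecs_def)
    have t'2: "lin (g (Suc i)) (A i) (t' j) = ?y j" if "j < h (Suc i)" for j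
      using t0 that by (simp add: t'_def)
    \<comment> \<open>Moving \<open>A i\<close> past \<open>t'\<close> leaves two consecutive
      differentials of \<open>B\<close>, so these vectors are cycles; exactness of \<open>A\<close>
      makes them boundaries.\<close>
    have "lin (h (Suc i)) t' (B (Suc i) j) \<in> lin (g (Suc (Suc i))) (A (Suc i)) ` vecs (g (Suc (Suc i)))"
      if j: "j < h (Suc (Suc i))" for j
    proof -
      have "lin (g (Suc i)) (A i) (lin (h (Suc i)) t' (B (Suc i) j)) =
          lin (h (Suc i)) (\<lambda>j. lin (g (Suc i)) (A i) (t' j)) (B (Suc i) j)"
        by (rule lin_lin)
      also have "\<dots> = lin (h (Suc i)) ?y (B (Suc i) j)"
        by (rule lin_cong) (rule t'2)
      also have "\<dots> = - lin (h i) t (lin (h (Suc i)) (B i) (B (Suc i) j))"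
        by (simp add: lin_uminus_matrix lin_lin)
      also have "\<dots> = 0" using BB[OF j] by simp
      finally show ?thesis using t'1 by (auto simp: exA intro: lin_in_vecs)
    qed
    then show "\<exists>t'. P (Suc i) t' \<and> (\<forall>j<h (Suc i). lin (g (Suc i)) (A i) (t' j) = ?y j)"
      using t'1 t'2 by (intro exI[of _ t']) (auto simp: P_def)
  qed
  then obtain f where "\<And>n. P n (f n)"
    "\<And>n j. j < h (Suc n) \<Longrightarrow> lin (g (Suc n)) (A n) (f (Suc n) j) = - lin (h n) (f n) (B n j)"
    by blast
  then show ?thesis by (intro exI[of _ f]) (auto simp: P_def)
qed

text \<open>Exactness is checked on pairs \<open>(v, w)\<close>. In a cycle, \<open>w\<close> is a
  boundary \<open>b i w'\<close>; subtracting the lift of \<open>w'\<close> from \<open>v\<close>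
  leaves a cycle in the resolution of R/I, hence a boundary there.\<close>

lemma lin_res_cone:
  fixes u :: "('n :: finite, 'k :: field) mpoly"
  assumes G: "lin_res I D g A" and K: "lin_res J 1 h B"
    and u: "u \<in> homogeneous_of D" and J: "J = {p. p * u \<in> I}"
  shows "\<exists>C. lin_res {p + q * u | p q. p \<in> I} D (\<lambda>i. g i + (case i of 0 \<Rightarrow> 0 | Suc i' \<Rightarrow> h i')) C"
proof -
  obtain \<tau> where \<tau>0: "\<tau> 0 = (\<lambda>j l. if l = 0 then u else 0)" and \<tau>v: "\<And>i j. \<tau> i j \<in> vecs (g i)"
    and \<tau>h: "\<And>i j l. \<tau> i j l \<in> homogeneous_of (if i = 0 then D else 1)"
    and \<tau>c: "\<And>i j. j < h (Suc i) \<Longrightarrow> lin (g (Suc i)) (A i) (\<tau> (Suc i) j) = - lin (h i) (\<tau> i) (B i j)"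
    using lin_res_chain_map[OF assms] by blast
  have g0: "g 0 = 1" and h0: "h 0 = 1" using G K by (auto simp: lin_res_def)
  have AD: "A i j l \<in> homogeneous_of (if i = 0 then D else 1)" if "j < g (Suc i)" for i j l
    using G that by (simp add: lin_res_def)
  have Av: "A i j \<in> vecs (g i)" if "j < g (Suc i)" for i j
    using G that by (simp add: lin_res_def)
  have Bv: "B i j \<in> vecs (h i)" if "j < h (Suc i)" for i j
    using K that by (simp add: lin_res_def)
  have B1: "B i j l \<in> homogeneous_of 1" if "j < h (Suc i)" for i j l
    using K that unfolding lin_res_def by (metis (full_types))
  \<comment> \<open>The resolution of R/J moved up by one position, with rank \<open>0\<close> in
    position \<open>0\<close>, so that one formula describes the cone everywhere.\<close>
  define hm where "hm i = (case i of 0 \<Rightarrow> 0 | Suc i' \<Rightarrow> h i')" for i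
  define Bm where "Bm i = (case i of 0 \<Rightarrow> 0 | Suc i' \<Rightarrow> B i')" for i
  have hm [simp]: "hm 0 = 0" "\<And>i. hm (Suc i) = h i" and Bm [simp]: "Bm 0 = 0" "\<And>i. Bm (Suc i) = B i"
    by (simp_all add: hm_def Bm_def)
  define a where "a i = lin (g (Suc i)) (A i)" for i
  define b where "b i = lin (h (Suc i)) (B i)" for i
  define bm where "bm i = lin (h i) (Bm i)" for i
  define t where "t i = lin (h i) (\<tau> i)" for i
  \<comment> \<open>The block matrix with rows \<open>(A, 0)\<close> and
    \<open>(\<tau>, Bm)\<close>. The rows of \<open>A i\<close> are padded implicitly, as they
    vanish from \<open>g i\<close> on.\<close>
  define C where "C i = append_vec (g (Suc i)) (A i) (\<lambda>j. append_vec (g i) (\<tau> i j) (Bm i j))" for i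
  define c where "c i = lin (g (Suc i) + h i) (C i)" for i
  have av: "a i v \<in> vecs (g i)" and tv: "t i w \<in> vecs (g i)" and bv: "b i w \<in> vecs (h i)"
    and bmv: "bm i w \<in> vecs (hm i)" for i v w
    unfolding a_def t_def b_def bm_def using Av Bv \<tau>v
    by (auto intro!: lin_in_vecs) (cases i; simp add: Bv; simp add: vecs_def)
  have ex_a: "a (Suc i) ` vecs (g (Suc (Suc i))) = {v \<in> vecs (g (Suc i)). a i v = 0}"
    and im_a: "a 0 ` vecs (g 1) = {v \<in> vecs 1. v 0 \<in> I}" for i
    using G by (simp_all add: a_def lin_res_def)
  have ex_b: "b (Suc i) ` vecs (h (Suc (Suc i))) = {v \<in> vecs (h (Suc i)). b i v = 0}"
    and im_b: "b 0 ` vecs (h 1) = {v \<in> vecs 1. v 0 \<in> J}" for i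
    using K by (simp_all add: b_def lin_res_def)
  have bm_Suc: "bm (Suc i) = b i" for i by (simp add: bm_def b_def)
  have bmb: "bm i (b i w) = 0" if "w \<in> vecs (h (Suc i))" for i w
    using ex_b that by (cases i) (auto simp: bm_Suc, simp add: bm_def lin_def fun_eq_iff)
  have at: "a i (t (Suc i) w) = - t i (b i w)" for i w
    unfolding a_def t_def b_def lin_lin
    by (subst lin_uminus_matrix[symmetric]) (rule lin_cong, simp add: \<tau>c)
  have c: "c i (append_vec (g (Suc i)) v w) = append_vec (g i) (a i v + t i w) (bm i w)" for i v w
  proof -
    have "c i (append_vec (g (Suc i)) v w) = a i v + append_vec (g i) (t i w) (bm i w)"
      by (simp add: c_def C_def lin_append lin_append_rows a_def t_def bm_def)
    also have "a i v = append_vec (g i) (a i v) 0" by (simp add: append_vec_zero av)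
    finally show ?thesis by (simp add: append_vec_add)
  qed
  have t0: "t 0 w = (\<lambda>l. if l = 0 then w 0 * u else 0)" for w
    by (simp add: t_def lin_def h0 \<tau>0 fun_eq_iff)
  have lin_a: "a i (v + w) = a i v + a i w" "a i (v - w) = a i v - a i w" "a i (- v) = - a i v" "a i 0 = 0" for i v w
    by (simp_all add: a_def lin_add lin_uminus lin_diff)
  have w_bound: "\<exists>w'\<in>vecs (h (Suc i)). w = b i w'"
    if v: "v \<in> vecs (g (Suc i))" and w: "w \<in> vecs (h i)" and z: "a i v + t i w = 0" "bm i w = 0" for i v w
  proof (cases i)
    case 0
    \<comment> \<open>In the lowest position \<open>w\<close> is a boundary because
      \<open>w 0 * u\<close> lies in \<open>I\<close>, that is, \<open>w 0\<close> lies in the colon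
      ideal \<open>J\<close>.\<close>
    have "t 0 w = a 0 (- v)" using z by (simp add: 0 lin_a eq_neg_iff_add_eq_0 add.commute)
    moreover have "a 0 (- v) \<in> a 0 ` vecs (g 1)"
      using v vecs_closed(3)[of v] by (simp add: 0)
    ultimately have "t 0 w \<in> {v \<in> vecs 1. v 0 \<in> I}" using im_a by simp
    then have "w 0 \<in> J" by (simp add: t0 J)
    then have "w \<in> b 0 ` vecs (h 1)" using w unfolding im_b by (simp add: 0 h0)
    then show ?thesis by (auto simp: 0)
  next
    case (Suc i')
    then have "w \<in> b (Suc i') ` vecs (h (Suc (Suc i')))"
      using w z by (simp add: ex_b bm_Suc)
    then show ?thesis by (auto simp: Suc)
  qed
  have zero_v: "append_vec m v w = 0 \<longleftrightarrow> v = 0 \<and> w = 0" if "v \<in> vecs m" for m v and w :: "nat \<Rightarrow> ('n,'k) mpoly"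
    using that by (rule append_vec_eq_zero_iff)
  have ex_c: "c (Suc i) ` vecs (g (Suc (Suc i)) + h (Suc i)) = {x \<in> vecs (g (Suc i) + h i). c i x = 0}" for i
  proof (intro equalityI subsetI)
    fix x assume "x \<in> c (Suc i) ` vecs (g (Suc (Suc i)) + h (Suc i))"
    then obtain y where y: "y \<in> vecs (g (Suc (Suc i)) + h (Suc i))" "x = c (Suc i) y" by blast
    obtain v w where v: "v \<in> vecs (g (Suc (Suc i)))" and w: "w \<in> vecs (h (Suc i))"
      and yvw: "y = append_vec (g (Suc (Suc i))) v w"
      using y(1) by (rule in_vecs_add_cases)
    have x: "x = c (Suc i) (append_vec (g (Suc (Suc i))) v w)" using y(2) yvw by simp
    have x': "x = append_vec (g (Suc i)) (a (Suc i) v + t (Suc i) w) (b i w)"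
      by (simp add: x c bm_Suc)
    have "a (Suc i) v \<in> {v \<in> vecs (g (Suc i)). a i v = 0}" using v ex_a by blast
    then have "c i x = 0"
      using w by (simp add: x' c lin_a at bmb) (simp add: append_vec_def fun_eq_iff)
    moreover have "x \<in> vecs (g (Suc i) + h i)"
      unfolding x' by (intro append_vec_in_vecs vecs_closed av tv bv)
    ultimately show "x \<in> {x \<in> vecs (g (Suc i) + h i). c i x = 0}" by simp
  next
    fix x assume x: "x \<in> {x \<in> vecs (g (Suc i) + h i). c i x = 0}"
    then have "x \<in> vecs (g (Suc i) + h i)" by simp
    then obtain v w where v: "v \<in> vecs (g (Suc i))" and w: "w \<in> vecs (h i)"
      and xvw: "x = append_vec (g (Suc i)) v w"
      by (rule in_vecs_add_cases)
    have "c i (append_vec (g (Suc i)) v w) = 0" using x xvw by simp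
    then have z: "a i v + t i w = 0" "bm i w = 0"
      unfolding c by (simp_all only: zero_v[OF vecs_closed(1)[OF av tv]])
    then obtain w' where w': "w' \<in> vecs (h (Suc i))" "w = b i w'" using w_bound v w by blast
    have "a i (v - t (Suc i) w') = a i v + t i w" using w' by (simp add: lin_a at)
    then have "v - t (Suc i) w' \<in> {v \<in> vecs (g (Suc i)). a i v = 0}"
      using z v tv by (simp add: vecs_closed)
    then obtain v' where v': "v' \<in> vecs (g (Suc (Suc i)))" "v - t (Suc i) w' = a (Suc i) v'"
      using ex_a by blast
    have "x = c (Suc i) (append_vec (g (Suc (Suc i))) v' w')"
      by (simp add: c xvw v'(2)[symmetric] bm_Suc w'(2))
    then show "x \<in> c (Suc i) ` vecs (g (Suc (Suc i)) + h (Suc i))"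
      using v' w' by (blast intro: append_vec_in_vecs)
  qed
  have im_c: "c 0 ` vecs (g 1 + h 0) = {x \<in> vecs 1. x 0 \<in> {p + q * u | p q. p \<in> I}}"
  proof (intro equalityI subsetI)
    fix x assume "x \<in> c 0 ` vecs (g 1 + h 0)"
    then obtain y where y: "y \<in> vecs (g 1 + h 0)" "x = c 0 y" by blast
    obtain v w where v: "v \<in> vecs (g 1)" and yvw: "y = append_vec (g 1) v w"
      using y(1) by (rule in_vecs_add_cases)
    have x: "x = c 0 (append_vec (g 1) v w)" using y(2) yvw by simp
    have "bm 0 w = 0" by (simp add: bm_def lin_def fun_eq_iff)
    then have x': "x = a 0 v + t 0 w"
      using x by (simp add: c append_vec_zero vecs_closed av tv)
    moreover have "a 0 v \<in> {v \<in> vecs 1. v 0 \<in> I}" using v im_a by blast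
    moreover have "t 0 w \<in> vecs 1" using tv[of 0] g0 by simp
    ultimately show "x \<in> {x \<in> vecs 1. x 0 \<in> {p + q * u | p q. p \<in> I}}"
      by (auto simp: vecs_closed t0)
  next
    fix x assume "x \<in> {x \<in> vecs 1. x 0 \<in> {p + q * u | p q. p \<in> I}}"
    then obtain p q where x: "x \<in> vecs 1" "x 0 = p + q * u" "p \<in> I" by blast
    have "(\<lambda>l. if l = 0 then p else 0) \<in> {v \<in> vecs 1. v 0 \<in> I}" using x by (simp add: vecs_def)
    then obtain v where v: "v \<in> vecs (g 1)" "(\<lambda>l. if l = 0 then p else 0) = a 0 v" using im_a by blast
    define w where "w = (\<lambda>l :: nat. if l = 0 then q else 0)"
    have w: "w \<in> vecs (h 0)" by (simp add: w_def h0 vecs_def)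
    have "bm 0 w = 0" by (simp add: bm_def lin_def fun_eq_iff)
    then have "c 0 (append_vec (g 1) v w) = a 0 v + t 0 w"
      using c[of 0 v w] by (simp add: append_vec_zero vecs_closed av tv)
    also have "\<dots> = x"
      using x(1) by (auto simp: v(2)[symmetric] t0 fun_eq_iff w_def x(2) vecs_def)
    finally show "x \<in> c 0 ` vecs (g 1 + h 0)"
      using append_vec_in_vecs[OF v(1) w] by blast
  qed
  have Cv: "C i j \<in> vecs (g i + hm i)" if "j < g (Suc i) + h i" for i j
  proof (cases "j < g (Suc i)")
    case True
    then show ?thesis using Av[OF True] by (auto simp: C_def append_vec_def vecs_def)
  next
    case False
    moreover have "Bm i k \<in> vecs (hm i)" if "k < h i" for k
      using that Bv by (cases i) (auto simp: vecs_def)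
    ultimately show ?thesis using \<tau>v that by (auto simp: C_def append_vec_def[of "g (Suc i)"] intro!: append_vec_in_vecs)
  qed
  have Ch: "C i j l \<in> homogeneous_of (if i = 0 then D else 1)" if "j < g (Suc i) + h i" for i j l
  proof (cases "j < g (Suc i)")
    case True
    then show ?thesis using AD[OF True] by (auto simp: C_def append_vec_def)
  next
    case False
    moreover have "Bm i k l \<in> homogeneous_of (if i = 0 then D else 1)" if "k < h i" for k l
      using that B1 by (cases i) auto
    ultimately show ?thesis
      using \<tau>h[of i "j - g (Suc i)"] that by (auto simp: C_def append_vec_def[of "g (Suc i)"]) (auto simp: append_vec_def)
  qed
  have "lin_res {p + q * u | p q. p \<in> I} D (\<lambda>i. g i + hm i) C"
    unfolding lin_res_def using ex_c im_c Cv Ch by (auto simp: g0 c_def)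
  then show ?thesis unfolding hm_def by blast
qed

section \<open>Monomial ideals and constant terms\<close>

lemma poly_ring_simps [simp]:
  "carrier poly_ring = UNIV" "zero poly_ring = 0" "one poly_ring = 1"
  "add poly_ring = (+)" "mult poly_ring = (*)"
  by (simp_all add: poly_ring_def)

text \<open>The ideal generated by the monomials in \<open>T\<close>, described through supports.
  Sums, colon ideals and membership can then be treated one monomial at a time.\<close>

definition monomial_span :: "('n \<Rightarrow>\<^sub>0 nat) set \<Rightarrow> ('n, 'k :: field) mpoly set"
  where "monomial_span T = {p. \<forall>m\<in>Poly_Mapping.keys p. \<exists>t\<in>T. mon_dvd t m}"

lemma poly_mapping_sum_single:
  fixes p :: "'a \<Rightarrow>\<^sub>0 'b :: comm_monoid_add"
  shows "p = (\<Sum>m\<in>Poly_Mapping.keys p. Poly_Mapping.single m (Poly_Mapping.lookup p m))"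
  by (rule poly_mapping_eqI)
    (simp add: lookup_sum lookup_single when_def in_keys_iff sum.delta' cong: if_cong)

lemma ideal_monomial_span: "ideal (monomial_span T :: ('n, 'k :: field) mpoly set) poly_ring"
proof -
  interpret R: cring "poly_ring :: ('n, 'k) mpoly ring" by (rule cring_poly_ring)
  show ?thesis
  proof (rule idealI)
    show "ring (poly_ring :: ('n, 'k) mpoly ring)" by (rule R.ring_axioms)
    show "subgroup (monomial_span T :: ('n, 'k) mpoly set) (add_monoid poly_ring)"
    proof (rule R.add.subgroupI)
      fix p q :: "('n, 'k) mpoly" assume pq: "p \<in> monomial_span T" "q \<in> monomial_span T"
      then show "p \<oplus>\<^bsub>poly_ring\<^esub> q \<in> monomial_span T"
        using keys_add[of p q] by (auto simp: monomial_span_def)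
      have "\<ominus>\<^bsub>poly_ring\<^esub> p = - p"
        by (rule R.minus_equality) simp_all
      then show "\<ominus>\<^bsub>poly_ring\<^esub> p \<in> monomial_span T"
        using pq by (simp add: monomial_span_def)
    next
      show "monomial_span T \<noteq> ({} :: ('n, 'k) mpoly set)"
        by (auto simp: monomial_span_def intro: exI[of _ 0])
    qed simp
  next
    fix p q :: "('n, 'k) mpoly" assume "p \<in> monomial_span T"
    then have "p * q \<in> monomial_span T"
      using keys_mult_dvd[of p T _ q] unfolding monomial_span_def by blast
    then show "q \<otimes>\<^bsub>poly_ring\<^esub> p \<in> monomial_span T" "p \<otimes>\<^bsub>poly_ring\<^esub> q \<in> monomial_span T"
      by (simp_all add: mult.commute)
  qed
qed

text \<open>Every polynomial is the sum of its terms, and a term whose monomial is divisible by a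
  generator is a multiple of that generator.\<close>

lemma Idl_xpow: "Idl\<^bsub>poly_ring\<^esub> (xpow ` T) = (monomial_span T :: ('n, 'k :: field) mpoly set)"
proof
  interpret R: cring "poly_ring :: ('n, 'k) mpoly ring" by (rule cring_poly_ring)
  have "xpow ` T \<subseteq> (monomial_span T :: ('n, 'k) mpoly set)"
    by (auto simp: monomial_span_def xpow_def mon_dvd_def intro!: bexI exI[of _ 0])
  then show "Idl\<^bsub>poly_ring\<^esub> (xpow ` T) \<subseteq> (monomial_span T :: ('n, 'k) mpoly set)"
    by (intro R.genideal_minimal ideal_monomial_span)
  interpret J: ideal "Idl\<^bsub>poly_ring\<^esub> (xpow ` T)" "poly_ring :: ('n, 'k) mpoly ring"
    by (rule R.genideal_ideal) simp
  have sum_mem: "sum f S \<in> Idl\<^bsub>poly_ring\<^esub> (xpow ` T)"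
    if "\<And>m. m \<in> S \<Longrightarrow> f m \<in> Idl\<^bsub>poly_ring\<^esub> (xpow ` T)"
    for S and f :: "('n \<Rightarrow>\<^sub>0 nat) \<Rightarrow> ('n, 'k) mpoly"
    using that
  proof (induction S rule: infinite_finite_induct)
    case (insert m S)
    then show ?case using J.a_closed[of "f m" "sum f S"] by simp
  qed (use J.zero_closed in simp_all)
  show "(monomial_span T :: ('n, 'k) mpoly set) \<subseteq> Idl\<^bsub>poly_ring\<^esub> (xpow ` T)"
  proof
    fix p :: "('n, 'k) mpoly" assume p: "p \<in> monomial_span T"
    have "Poly_Mapping.single m (Poly_Mapping.lookup p m) \<in> Idl\<^bsub>poly_ring\<^esub> (xpow ` T)"
      if "m \<in> Poly_Mapping.keys p" for m
    proof -
      have "(xpow m :: ('n, 'k) mpoly) \<in> Idl\<^bsub>poly_ring\<^esub> (xpow ` T)"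
        using p that by (simp add: xpow_mem_Idl_iff monomial_span_def)
      from J.I_l_closed[OF this, of "Poly_Mapping.single 0 (Poly_Mapping.lookup p m)"]
      show ?thesis by (simp add: xpow_def mult_single)
    qed
    then show "p \<in> Idl\<^bsub>poly_ring\<^esub> (xpow ` T)"
      by (subst poly_mapping_sum_single[of p]) (rule sum_mem)
  qed
qed

lemma irrelevant_ideal_eq:
  "irrelevant_ideal = (monomial_span (range (\<lambda>i. Poly_Mapping.single i 1)) :: ('n, 'k :: field) mpoly set)"
proof -
  have "range var = (xpow ` range (\<lambda>i. Poly_Mapping.single i 1) :: ('n, 'k) mpoly set)"
    by (auto simp: var_def)
  then show ?thesis by (simp add: irrelevant_ideal_def Idl_xpow)
qed

lemma mon_add_eq_zero_iff: "u + v = 0 \<longleftrightarrow> u = 0 \<and> v = (0 :: 'n \<Rightarrow>\<^sub>0 nat)"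
  by (auto simp: poly_mapping_eq_iff fun_eq_iff lookup_add)

text \<open>Taking the constant term serves as reduction modulo the irrelevant ideal; it turns
  matrices over R into matrices over the field.\<close>

lemma irrelevant_ideal_constant_term:
  fixes p :: "('n, 'k :: field) mpoly"
  assumes "p \<in> irrelevant_ideal"
  shows "Poly_Mapping.lookup p 0 = 0"
proof (rule ccontr)
  assume "Poly_Mapping.lookup p 0 \<noteq> 0"
  then have "0 \<in> Poly_Mapping.keys p" by (simp add: in_keys_iff)
  then obtain i :: 'n where "mon_dvd (Poly_Mapping.single i 1) 0"
    using assms unfolding irrelevant_ideal_eq monomial_span_def by blast
  then obtain h where "0 = Poly_Mapping.single i (1 :: nat) + h"
    unfolding mon_dvd_def ..
  then have "Poly_Mapping.single i (1 :: nat) = 0" by (metis mon_add_eq_zero_iff)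
  then show False by (metis lookup_single_eq lookup_zero zero_neq_one)
qed

lemma homogeneous_of_one_irrelevant:
  fixes p :: "('n :: finite, 'k :: field) mpoly"
  assumes "p \<in> homogeneous_of 1"
  shows "p \<in> irrelevant_ideal"
  unfolding irrelevant_ideal_eq monomial_span_def
proof clarify
  fix m assume "m \<in> Poly_Mapping.keys p"
  then have "mon_deg m = 1" using assms by (auto simp: homogeneous_of_def)
  then have "m \<noteq> 0" by (auto simp: mon_deg_def)
  then obtain i where "Poly_Mapping.lookup m i \<noteq> 0" by (metis poly_mapping_eqI lookup_zero)
  then have "m = Poly_Mapping.single i 1 + (m - Poly_Mapping.single i 1)"
    by (intro poly_mapping_eqI) (auto simp: lookup_add lookup_minus lookup_single when_def)
  then show "\<exists>t\<in>range (\<lambda>i. Poly_Mapping.single i 1). mon_dvd t m"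
    unfolding mon_dvd_def by blast
qed

text \<open>Exponent vectors add up to zero only if both are zero, so only the two constant terms
  contribute.\<close>

lemma lookup_mult_zero:
  fixes p q :: "('n, 'k :: field) mpoly"
  shows "Poly_Mapping.lookup (p * q) 0 = Poly_Mapping.lookup p 0 * Poly_Mapping.lookup q 0"
proof -
  define c where "c = (Poly_Mapping.single 0 (Poly_Mapping.lookup p 0) :: ('n, 'k) mpoly)"
  define e where "e = (Poly_Mapping.single 0 (Poly_Mapping.lookup q 0) :: ('n, 'k) mpoly)"
  have "0 \<notin> Poly_Mapping.keys (p - c)" "0 \<notin> Poly_Mapping.keys (q - e)"
    by (simp_all add: in_keys_iff lookup_minus c_def e_def)
  then have "0 \<notin> Poly_Mapping.keys ((p - c) * q)" "0 \<notin> Poly_Mapping.keys (c * (q - e))"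
    using keys_mult[of "p - c" q] keys_mult[of c "q - e"]
    by (auto simp: mon_add_eq_zero_iff dest!: subsetD sym[of 0])
  moreover have "p * q = (p - c) * q + c * (q - e) + c * e"
    by (simp add: algebra_simps)
  ultimately show ?thesis
    by (simp add: lookup_add in_keys_iff c_def e_def mult_single)
qed

section \<open>Linear algebra over the coefficient field\<close>

text \<open>Gaussian elimination, by induction on the number of equations: the last equation is
  either trivial or can be solved for one unknown.\<close>

lemma exists_nontrivial_solution:
  fixes M :: "'a \<Rightarrow> nat \<Rightarrow> 'k :: field"
  assumes "finite A" "n < card A"
  shows "\<exists>c. (\<exists>j\<in>A. c j \<noteq> 0) \<and> (\<forall>k<n. (\<Sum>j\<in>A. c j * M j k) = 0)"
  using assms
proof (induction n arbitrary: A M)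
  case 0
  then have "A \<noteq> {}" by auto
  then show ?case by (intro exI[of _ "\<lambda>_. 1"]) auto
next
  case (Suc n)
  show ?case
  proof (cases "\<forall>j\<in>A. M j n = 0")
    case True
    obtain c where "\<exists>j\<in>A. c j \<noteq> 0" "\<forall>k<n. (\<Sum>j\<in>A. c j * M j k) = 0"
      using Suc.IH[of A M] Suc.prems by auto
    then show ?thesis using True by (intro exI[of _ c]) (auto simp: less_Suc_eq)
  next
    case False
    then obtain r where r: "r \<in> A" "M r n \<noteq> 0" by blast
    \<comment> \<open>The coefficients that arise when the last equation is solved for the unknown
      with index \<open>r\<close> and the result is substituted into the others.\<close>
    define M' where "M' j k = M j k - M j n / M r n * M r k" for j k
    have "n < card (A - {r})" using Suc.prems r by simp
    then obtain c where c: "\<exists>j\<in>A - {r}. c j \<noteq> 0"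
      "\<And>k. k < n \<Longrightarrow> (\<Sum>j\<in>A - {r}. c j * M' j k) = 0"
      using Suc.IH[of "A - {r}" M'] Suc.prems by auto
    define s where "s = (\<Sum>j\<in>A - {r}. c j * M j n)"
    define c' where "c' = c(r := - s / M r n)"
    have sum_c': "(\<Sum>j\<in>A. c' j * M j k) = (\<Sum>j\<in>A - {r}. c j * M j k) - s / M r n * M r k" for k
    proof -
      have "(\<Sum>j\<in>A. c' j * M j k) = c' r * M r k + (\<Sum>j\<in>A - {r}. c' j * M j k)"
        using Suc.prems r by (intro sum.remove)
      also have "(\<Sum>j\<in>A - {r}. c' j * M j k) = (\<Sum>j\<in>A - {r}. c j * M j k)"
        by (rule sum.cong) (auto simp: c'_def)
      finally show ?thesis by (simp add: c'_def)
    qed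
    have "(\<Sum>j\<in>A. c' j * M j k) = 0" if "k < Suc n" for k
    proof (cases "k = n")
      case True
      then show ?thesis using r by (simp add: sum_c' s_def)
    next
      case False
      then have "(\<Sum>j\<in>A - {r}. c j * M' j k) = 0" using that c by simp
      then show ?thesis
        by (simp add: sum_c' M'_def s_def algebra_simps sum_subtractf sum_distrib_left sum_divide_distrib)
    qed
    moreover have "\<exists>j\<in>A. c' j \<noteq> 0" using c(1) by (auto simp: c'_def)
    ultimately show ?thesis by blast
  qed
qed

text \<open>If \<open>b\<close> exceeded \<open>b'\<close>, a nonzero row vector \<open>c\<close>
  would satisfy \<open>c M = 0\<close>, yet \<open>c = c M N\<close>.\<close>

lemma left_invertible_matrix_bound:
  fixes M N :: "nat \<Rightarrow> nat \<Rightarrow> 'k :: field"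
  assumes MN: "\<And>j l. j < b \<Longrightarrow> l < b \<Longrightarrow> (\<Sum>k<b'. M j k * N k l) = (if j = l then 1 else 0)"
  shows "b \<le> b'"
proof (rule ccontr)
  assume "\<not> b \<le> b'"
  then obtain c where c: "\<exists>j\<in>{..<b}. c j \<noteq> 0" "\<And>k. k < b' \<Longrightarrow> (\<Sum>j<b. c j * M j k) = 0"
    using exists_nontrivial_solution[of "{..<b}" b' M] by auto
  have "c l = 0" if l: "l < b" for l
  proof -
    have "c l = (\<Sum>j<b. c j * (if j = l then 1 else 0))" using l by (simp add: if_distrib cong: if_cong)
    also have "\<dots> = (\<Sum>j<b. c j * (\<Sum>k<b'. M j k * N k l))" using MN l by (intro sum.cong) auto
    also have "\<dots> = (\<Sum>k<b'. (\<Sum>j<b. c j * M j k) * N k l)"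
      unfolding sum_distrib_left sum_distrib_right by (subst sum.swap) (simp only: mult.assoc)
    finally show ?thesis by (simp add: c)
  qed
  then show False using c(1) by simp
qed

section \<open>Modules and comparison of resolutions\<close>

lemma lin_mapsD:
  assumes "h \<in> lin_maps R M N"
  shows "x \<in> carrier M \<Longrightarrow> h x \<in> carrier N"
    "x \<in> carrier M \<Longrightarrow> y \<in> carrier M \<Longrightarrow> h (x \<oplus>\<^bsub>M\<^esub> y) = h x \<oplus>\<^bsub>N\<^esub> h y"
    "r \<in> carrier R \<Longrightarrow> x \<in> carrier M \<Longrightarrow> h (r \<odot>\<^bsub>M\<^esub> x) = r \<odot>\<^bsub>N\<^esub> h x"
  using assms by (auto simp: lin_maps_def)

lemma lin_mapsI:
  assumes "\<And>x. x \<in> carrier M \<Longrightarrow> h x \<in> carrier N"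
    "\<And>x y. x \<in> carrier M \<Longrightarrow> y \<in> carrier M \<Longrightarrow> h (x \<oplus>\<^bsub>M\<^esub> y) = h x \<oplus>\<^bsub>N\<^esub> h y"
    "\<And>r x. r \<in> carrier R \<Longrightarrow> x \<in> carrier M \<Longrightarrow> h (r \<odot>\<^bsub>M\<^esub> x) = r \<odot>\<^bsub>N\<^esub> h x"
  shows "h \<in> lin_maps R M N"
  using assms by (auto simp: lin_maps_def)

lemma lin_maps_comp:
  assumes "f \<in> lin_maps R M N" "g \<in> lin_maps R N P"
  shows "(\<lambda>x. g (f x)) \<in> lin_maps R M P"
  by (rule lin_mapsI) (simp_all add: lin_mapsD[OF assms(1)] lin_mapsD[OF assms(2)])

lemma lin_maps_id: "(\<lambda>x. x) \<in> lin_maps R M M"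
  by (rule lin_mapsI) simp_all

lemma lin_maps_zero:
  assumes "Module.module R M" "Module.module R N" "h \<in> lin_maps R M N"
  shows "h \<zero>\<^bsub>M\<^esub> = \<zero>\<^bsub>N\<^esub>"
proof -
  interpret M: Module.module R M by fact
  interpret N: Module.module R N by fact
  have "h \<zero>\<^bsub>M\<^esub> = h (\<zero>\<^bsub>R\<^esub> \<odot>\<^bsub>M\<^esub> \<zero>\<^bsub>M\<^esub>)" by simp
  also have "\<dots> = \<zero>\<^bsub>R\<^esub> \<odot>\<^bsub>N\<^esub> h \<zero>\<^bsub>M\<^esub>"
    using assms(3) by (intro lin_mapsD(3)) auto
  also have "\<dots> = \<zero>\<^bsub>N\<^esub>" using lin_mapsD(1)[OF assms(3)] by simp
  finally show ?thesis .
qed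

section \<open>Free modules and the lifting property\<close>

lemma free_module_simps [simp]:
  "carrier (free_module poly_ring X) = {f. finite {x. f x \<noteq> 0} \<and> {x. f x \<noteq> 0} \<subseteq> X}"
  "zero (free_module poly_ring X) = (\<lambda>_. 0)"
  "add (free_module poly_ring X) = (\<lambda>f g x. f x + g x)"
  "smult (free_module poly_ring X) = (\<lambda>r f x. r * f x)"
  by (auto simp: free_module_def)

lemma module_free_module: "Module.module poly_ring (free_module (poly_ring :: ('n, 'k :: field) mpoly ring) X)"
proof (rule Module.moduleI)
  show "cring (poly_ring :: ('n, 'k) mpoly ring)" by (rule cring_poly_ring)
  have fin: "finite {x. f x + g x \<noteq> 0}" if "finite {x. f x \<noteq> 0}" "finite {x. g x \<noteq> 0}"
    for f g :: "'a \<Rightarrow> ('n, 'k) mpoly"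
    using finite_UnI[OF that] by (rule finite_subset[rotated]) auto
  show "abelian_group (free_module (poly_ring :: ('n, 'k) mpoly ring) X)"
  proof (rule abelian_groupI)
    fix x y assume "x \<in> carrier (free_module (poly_ring :: ('n, 'k) mpoly ring) X)"
      "y \<in> carrier (free_module (poly_ring :: ('n, 'k) mpoly ring) X)"
    then show "x \<oplus>\<^bsub>free_module poly_ring X\<^esub> y \<in> carrier (free_module poly_ring X)"
      using fin[of x y] by (auto dest!: subsetD)
  next
    fix x assume "x \<in> carrier (free_module (poly_ring :: ('n, 'k) mpoly ring) X)"
    then show "\<exists>y\<in>carrier (free_module poly_ring X). y \<oplus>\<^bsub>free_module poly_ring X\<^esub> x = \<zero>\<^bsub>free_module poly_ring X\<^esub>"
      by (intro bexI[of _ "- x"]) (auto simp: fun_eq_iff)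
  qed (simp_all add: ac_simps)
  fix r :: "('n, 'k) mpoly" and x
  assume "x \<in> carrier (free_module (poly_ring :: ('n, 'k) mpoly ring) X)"
  then show "r \<odot>\<^bsub>free_module poly_ring X\<^esub> x \<in> carrier (free_module poly_ring X)"
    by (auto elim: finite_subset[rotated])
qed (auto simp: algebra_simps fun_eq_iff)

definition summand_of_free :: "('r, 'q) ring_scheme \<Rightarrow> 'x set \<Rightarrow> ('r, 'c) module \<Rightarrow> bool"
  where "summand_of_free R X P \<longleftrightarrow>
    (\<exists>s p. s \<in> lin_maps R P (free_module R X) \<and> p \<in> lin_maps R (free_module R X) P \<and>
       (\<forall>x\<in>carrier P. p (s x) = x))"

lemma summand_of_free_self: "summand_of_free R X (free_module R X)"
  unfolding summand_of_free_def using lin_maps_id by blast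

lemma unit_vec_in_free: "x \<in> X \<Longrightarrow> unit_vec x \<in> carrier (free_module poly_ring X)"
  by (auto simp: unit_vec_def)

lemma free_module_induct [consumes 1, case_names zero step]:
  fixes v :: "'x \<Rightarrow> ('n, 'k :: field) mpoly"
  assumes v: "v \<in> carrier (free_module poly_ring X)"
    and z: "P (\<lambda>_. 0)"
    and s: "\<And>v x r. v \<in> carrier (free_module poly_ring X) \<Longrightarrow> P v \<Longrightarrow> x \<in> X \<Longrightarrow>
        P (\<lambda>y. v y + r * unit_vec x y)"
  shows "P v"
proof -
  have "finite {x. v x \<noteq> 0}" and vX: "{x. v x \<noteq> 0} \<subseteq> X" using v by auto
  then have "\<forall>w. {x. w x \<noteq> 0} \<subseteq> {x. v x \<noteq> 0} \<longrightarrow> P w"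
  proof (induction "{x. v x \<noteq> 0}" arbitrary: v rule: finite_induct)
    case empty
    then have "v = (\<lambda>_. 0)" by (auto simp: fun_eq_iff)
    then show ?case by (auto simp: fun_eq_iff) (metis z ext)
  next
    case (insert x F)
    show ?case
    proof (intro allI impI)
      fix w :: "'x \<Rightarrow> ('n, 'k) mpoly"
      assume w: "{x. w x \<noteq> 0} \<subseteq> {x. v x \<noteq> 0}"
      have x: "x \<in> X" using insert.hyps(4) insert.prems by blast
      define v' where "v' = v(x := 0)"
      define w' where "w' = w(x := 0)"
      have F: "F = {x. v' x \<noteq> 0}" using insert.hyps(2,4) by (auto simp: v'_def)
      have w': "{x. w' x \<noteq> 0} \<subseteq> {x. v' x \<noteq> 0}" using w by (auto simp: v'_def w'_def)
      have vX': "{x. v' x \<noteq> 0} \<subseteq> X" using insert.prems by (auto simp: v'_def)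
      have "P w'" using insert.hyps(3)[OF F vX'] w' by blast
      moreover have "w' \<in> carrier (free_module poly_ring X)"
        using w' vX' F insert.hyps(1) by (auto intro: finite_subset)
      ultimately have "P (\<lambda>y. w' y + w x * unit_vec x y)" using s x by blast
      also have "(\<lambda>y. w' y + w x * unit_vec x y) = w" by (auto simp: w'_def unit_vec_def)
      finally show "P w" .
    qed
  qed
  then show ?thesis by blast
qed

lemma lin_maps_free_eqI:
  fixes f g :: "('x \<Rightarrow> ('n, 'k :: field) mpoly) \<Rightarrow> 'm"
  assumes "Module.module poly_ring M"
    and f: "f \<in> lin_maps poly_ring (free_module poly_ring X) M"
    and g: "g \<in> lin_maps poly_ring (free_module poly_ring X) M"
    and eq: "\<And>x. x \<in> X \<Longrightarrow> f (unit_vec x) = g (unit_vec x)"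
    and v: "v \<in> carrier (free_module poly_ring X)"
  shows "f v = g v"
  using v
proof (induction rule: free_module_induct)
  case zero
  then show ?case
    using lin_maps_zero[OF module_free_module assms(1) f] lin_maps_zero[OF module_free_module assms(1) g] by simp
next
  case (step v x r)
  let ?F = "free_module poly_ring X"
  have x: "unit_vec x \<in> carrier ?F" "r \<odot>\<^bsub>?F\<^esub> unit_vec x \<in> carrier ?F"
    using unit_vec_in_free[OF step.hyps(2)] Module.module.smult_closed[OF module_free_module, of r "unit_vec x" X] by simp_all
  have *: "h (\<lambda>y. v y + r * unit_vec x y) = h v \<oplus>\<^bsub>M\<^esub> r \<odot>\<^bsub>M\<^esub> h (unit_vec x)"
    if h: "h \<in> lin_maps poly_ring ?F M" for h
    using lin_mapsD(2)[OF h step.hyps(1) x(2)] lin_mapsD(3)[OF h _ x(1), of r] by simp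
  show ?case using *[OF f] *[OF g] step.IH eq[OF step.hyps(2)] by simp
qed

text \<open>The universal property of free modules: the map sends a vector to the corresponding
  finite combination of the prescribed values.\<close>

lemma free_module_extension:
  fixes M :: "(('n, 'k :: field) mpoly, 'm) module"
  assumes M: "Module.module poly_ring M" and b: "\<And>x. x \<in> X \<Longrightarrow> b x \<in> carrier M"
  shows "\<exists>h\<in>lin_maps poly_ring (free_module poly_ring X) M. \<forall>x\<in>X. h (unit_vec x) = b x"
proof -
  interpret M: Module.module poly_ring M by fact
  let ?F = "free_module (poly_ring :: ('n, 'k) mpoly ring) X"
  define h where "h v = finsum M (\<lambda>x. v x \<odot>\<^bsub>M\<^esub> b x) {x. v x \<noteq> 0}" for v
  have [simp]: "0 \<odot>\<^bsub>M\<^esub> x = \<zero>\<^bsub>M\<^esub>" if "x \<in> carrier M" for x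
    using M.smult_l_null[OF that] by simp
  \<comment> \<open>Supports change under addition and scaling, so the sum is first freed from the
    support: every finite set between it and \<open>X\<close> gives the same value.\<close>
  have h_eq: "h v = finsum M (\<lambda>x. v x \<odot>\<^bsub>M\<^esub> b x) S"
    if "finite S" "{x. v x \<noteq> 0} \<subseteq> S" "S \<subseteq> X" for v S
    unfolding h_def using that b
    by (intro M.add.finprod_mono_neutral_cong_left) (auto simp: Pi_def)
  have "h \<in> lin_maps poly_ring ?F M"
  proof (rule lin_mapsI)
    fix v assume v: "v \<in> carrier ?F"
    show "h v \<in> carrier M" unfolding h_def using v b by (intro M.finsum_closed) auto
    fix r :: "('n, 'k) mpoly"
    let ?S = "{x. v x \<noteq> 0}"
    have "h (r \<odot>\<^bsub>?F\<^esub> v) = finsum M (\<lambda>x. (r * v x) \<odot>\<^bsub>M\<^esub> b x) ?S"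
      using v by (subst h_eq[of ?S]) auto
    also have "\<dots> = finsum M (\<lambda>x. r \<odot>\<^bsub>M\<^esub> (v x \<odot>\<^bsub>M\<^esub> b x)) ?S"
      using v b M.smult_assoc1 by (intro M.finsum_cong') (auto simp: Pi_def subset_iff)
    also have "\<dots> = r \<odot>\<^bsub>M\<^esub> h v"
      unfolding h_def using v b by (intro M.finsum_smult_ldistr[symmetric]) auto
    finally show "h (r \<odot>\<^bsub>?F\<^esub> v) = r \<odot>\<^bsub>M\<^esub> h v" .
  next
    fix v w assume vw: "v \<in> carrier ?F" "w \<in> carrier ?F"
    let ?S = "{x. v x \<noteq> 0} \<union> {x. w x \<noteq> 0}"
    have S: "finite ?S" "?S \<subseteq> X" using vw by auto
    have "h (v \<oplus>\<^bsub>?F\<^esub> w) = finsum M (\<lambda>x. (v x + w x) \<odot>\<^bsub>M\<^esub> b x) ?S"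
      using S by (subst h_eq[of ?S]) auto
    also have "\<dots> = finsum M (\<lambda>x. v x \<odot>\<^bsub>M\<^esub> b x \<oplus>\<^bsub>M\<^esub> w x \<odot>\<^bsub>M\<^esub> b x) ?S"
      using S b M.smult_l_distr by (intro M.finsum_cong') (auto simp: Pi_def subset_iff)
    also have "\<dots> = finsum M (\<lambda>x. v x \<odot>\<^bsub>M\<^esub> b x) ?S \<oplus>\<^bsub>M\<^esub> finsum M (\<lambda>x. w x \<odot>\<^bsub>M\<^esub> b x) ?S"
      using S b by (intro M.finsum_addf) auto
    also have "\<dots> = h v \<oplus>\<^bsub>M\<^esub> h w"
      using h_eq[of ?S v] h_eq[of ?S w] S by simp
    finally show "h (v \<oplus>\<^bsub>?F\<^esub> w) = h v \<oplus>\<^bsub>M\<^esub> h w" .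
  qed
  moreover have "h (unit_vec x) = b x" if "x \<in> X" for x
  proof -
    have "h (unit_vec x) = finsum M (\<lambda>y. unit_vec x y \<odot>\<^bsub>M\<^esub> b y) {x}"
      using that by (intro h_eq) (auto simp: unit_vec_def)
    also have "\<dots> = b x" using b[OF that] M.smult_one[of "b x"] by (simp add: unit_vec_def)
    finally show ?thesis .
  qed
  ultimately show ?thesis by blast
qed

text \<open>The lifting property of projectives, with an inclusion of images in place of
  surjectivity, which is the form that exactness provides. Lifts of the basis elements define a map
  on the free module, and the section \<open>s\<close> pulls it back to \<open>Q\<close>.\<close>

lemma lin_maps_lift:
  fixes B :: "(('n, 'k :: field) mpoly, 'b) module" and C :: "(('n, 'k) mpoly, 'c) module"
  assumes B: "Module.module poly_ring B" and C: "Module.module poly_ring C"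
    and f: "f \<in> lin_maps poly_ring B C" and Q: "summand_of_free poly_ring X Q"
    and g: "g \<in> lin_maps poly_ring Q C" and im: "\<And>x. x \<in> carrier Q \<Longrightarrow> g x \<in> f ` carrier B"
  shows "\<exists>h\<in>lin_maps poly_ring Q B. \<forall>x\<in>carrier Q. f (h x) = g x"
proof -
  let ?F = "free_module poly_ring X"
  obtain s p where s: "s \<in> lin_maps poly_ring Q ?F" and p: "p \<in> lin_maps poly_ring ?F Q"
    and ps: "\<And>x. x \<in> carrier Q \<Longrightarrow> p (s x) = x"
    using Q unfolding summand_of_free_def by blast
  have "\<exists>y\<in>carrier B. f y = g (p (unit_vec x))" if "x \<in> X" for x
    using im[OF lin_mapsD(1)[OF p unit_vec_in_free[OF that]]] by (metis imageE)
  then obtain b where b: "\<And>x. x \<in> X \<Longrightarrow> b x \<in> carrier B \<and> f (b x) = g (p (unit_vec x))" by metis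
  then obtain h where h: "h \<in> lin_maps poly_ring ?F B" "\<And>x. x \<in> X \<Longrightarrow> h (unit_vec x) = b x"
    using free_module_extension[OF B, of X b] by blast
  have "f (h v) = g (p v)" if "v \<in> carrier ?F" for v
    using C lin_maps_comp[OF h(1) f] lin_maps_comp[OF p g] _ that
    by (rule lin_maps_free_eqI) (simp add: h b)
  then have "f (h (s x)) = g x" if "x \<in> carrier Q" for x
    using that ps lin_mapsD(1)[OF s] by simp
  then show ?thesis using lin_maps_comp[OF s h(1)] by (intro bexI[of _ "\<lambda>x. h (s x)"]) auto
qed

section \<open>Chain maps and homotopies between resolutions\<close>

lemma resolutionD:
  assumes "resolution R M P d \<epsilon>"
  shows "Module.module R M" "Module.module R (P i)" "d i \<in> lin_maps R (P (Suc i)) (P i)"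
    "\<epsilon> \<in> lin_maps R (P 0) M" "\<epsilon> ` carrier (P 0) = carrier M"
    "d 0 ` carrier (P (Suc 0)) = {x \<in> carrier (P 0). \<epsilon> x = \<zero>\<^bsub>M\<^esub>}"
    "d (Suc i) ` carrier (P (Suc (Suc i))) = {x \<in> carrier (P (Suc i)). d i x = \<zero>\<^bsub>P i\<^esub>}"
  using assms by (simp_all add: resolution_def)

text \<open>Projectivity is asked of the source \<open>Q\<close>, exactness is used in both. The
  invariant \<open>A\<close> records that the map chosen so far sends boundaries of \<open>Q\<close>
  into boundaries of \<open>P\<close>, which is what \<open>lin_maps_lift\<close> needs in the next
  position.\<close>

lemma resolution_comparison:
  fixes M :: "(('n, 'k :: field) mpoly, 'm) module"
    and P :: "nat \<Rightarrow> (('n, 'k) mpoly, 'p) module" and Q :: "nat \<Rightarrow> (('n, 'k) mpoly, 'q) module"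
    and X :: "nat \<Rightarrow> 'x set"
  assumes P: "resolution poly_ring M P d \<epsilon>" and Q: "resolution poly_ring M Q d' \<epsilon>'"
    and X: "\<And>i. summand_of_free poly_ring (X i) (Q i)"
  shows "\<exists>\<phi>. (\<forall>i. \<phi> i \<in> lin_maps poly_ring (Q i) (P i)) \<and> (\<forall>x\<in>carrier (Q 0). \<epsilon> (\<phi> 0 x) = \<epsilon>' x) \<and>
    (\<forall>i. \<forall>x\<in>carrier (Q (Suc i)). d i (\<phi> (Suc i) x) = \<phi> i (d' i x))"
proof -
  note p = resolutionD[OF P] and q = resolutionD[OF Q]
  define A where "A i h \<longleftrightarrow> h \<in> lin_maps poly_ring (Q i) (P i) \<and>
    (i = 0 \<longrightarrow> (\<forall>x\<in>carrier (Q 0). \<epsilon> (h x) = \<epsilon>' x)) \<and>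
    (\<forall>x\<in>carrier (Q (Suc i)). h (d' i x) \<in> d i ` carrier (P (Suc i)))" for i h
  have "\<exists>\<phi>. \<forall>i. A i (\<phi> i) \<and> (\<forall>x\<in>carrier (Q (Suc i)). d i (\<phi> (Suc i) x) = \<phi> i (d' i x))"
  proof (rule dependent_nat_choice)
    obtain h where h: "h \<in> lin_maps poly_ring (Q 0) (P 0)" "\<And>x. x \<in> carrier (Q 0) \<Longrightarrow> \<epsilon> (h x) = \<epsilon>' x"
      using lin_maps_lift[OF p(2) p(1) p(4) X q(4)] p(5) q(5) by (metis imageI)
    have "h (d' 0 x) \<in> d 0 ` carrier (P (Suc 0))" if "x \<in> carrier (Q (Suc 0))" for x
    proof -
      have "d' 0 x \<in> {x \<in> carrier (Q 0). \<epsilon>' x = \<zero>\<^bsub>M\<^esub>}" using that q(6) by blast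
      then show ?thesis unfolding p(6) using h(2) lin_mapsD(1)[OF h(1)] by simp
    qed
    then show "\<exists>h. A 0 h" using h by (auto simp: A_def)
  next
    fix h i assume A: "A i h"
    have gl: "(\<lambda>x. h (d' i x)) \<in> lin_maps poly_ring (Q (Suc i)) (P i)"
      by (rule lin_maps_comp[OF q(3)]) (use A in \<open>simp add: A_def\<close>)
    obtain h' where h': "h' \<in> lin_maps poly_ring (Q (Suc i)) (P (Suc i))"
      "\<And>x. x \<in> carrier (Q (Suc i)) \<Longrightarrow> d i (h' x) = h (d' i x)"
      using lin_maps_lift[OF p(2) p(2) p(3) X gl] A unfolding A_def by blast
    have "h' (d' (Suc i) x) \<in> d (Suc i) ` carrier (P (Suc (Suc i)))" if "x \<in> carrier (Q (Suc (Suc i)))" for x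
    proof -
      have y: "d' (Suc i) x \<in> {x \<in> carrier (Q (Suc i)). d' i x = \<zero>\<^bsub>Q i\<^esub>}" using that q(7) by blast
      then have "d i (h' (d' (Suc i) x)) = h \<zero>\<^bsub>Q i\<^esub>" using h'(2) by simp
      also have "\<dots> = \<zero>\<^bsub>P i\<^esub>" using A by (intro lin_maps_zero[OF q(2) p(2)]) (simp add: A_def)
      finally show ?thesis unfolding p(7) using y lin_mapsD(1)[OF h'(1)] by simp
    qed
    then show "\<exists>h'. A (Suc i) h' \<and> (\<forall>x\<in>carrier (Q (Suc i)). d i (h' x) = h (d' i x))"
      using h' by (intro exI[of _ h']) (auto simp: A_def)
  qed
  then obtain \<phi> where "\<And>i. A i (\<phi> i)" "\<And>i x. x \<in> carrier (Q (Suc i)) \<Longrightarrow> d i (\<phi> (Suc i) x) = \<phi> i (d' i x)"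
    by blast
  then show ?thesis by (intro exI[of _ \<phi>]) (auto simp: A_def)
qed

lemma free_module_vecs:
  fixes b :: nat
  shows "carrier (free_module poly_ring {..<b}) = vecs b" "zero (free_module poly_ring {..<b}) = 0"
    "add (free_module poly_ring {..<b}) = (+)" "smult (free_module poly_ring {..<b}) = (\<lambda>r v l. r * v l)"
proof -
  have "finite {x. f x \<noteq> 0} \<and> {x. f x \<noteq> 0} \<subseteq> {..<b} \<longleftrightarrow> f \<in> vecs b"
    for f :: "nat \<Rightarrow> ('a, 'b) mpoly"
  proof
    assume "f \<in> vecs b"
    then have "{x. f x \<noteq> 0} \<subseteq> {..<b}" by (auto simp: vecs_def) (meson linorder_not_le)
    then show "finite {x. f x \<noteq> 0} \<and> {x. f x \<noteq> 0} \<subseteq> {..<b}" by (auto intro: finite_subset)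
  qed (auto simp: vecs_def)
  then show "carrier (free_module poly_ring {..<b}) = (vecs b :: (nat \<Rightarrow> ('a, 'b) mpoly) set)" by simp
qed (simp_all add: fun_eq_iff)

lemma lin_maps_vecsI:
  assumes "\<And>v. v \<in> vecs m \<Longrightarrow> h v \<in> vecs n"
    "\<And>v w. v \<in> vecs m \<Longrightarrow> w \<in> vecs m \<Longrightarrow> h (v + w) = h v + h w"
    "\<And>r v. v \<in> vecs m \<Longrightarrow> h (\<lambda>l. r * v l) = (\<lambda>l. r * h v l)"
  shows "h \<in> lin_maps poly_ring (free_module poly_ring {..<m}) (free_module poly_ring {..<n})"
  using assms by (intro lin_mapsI) (simp_all only: free_module_vecs)

context
  fixes h :: "(nat \<Rightarrow> ('n, 'k :: field) mpoly) \<Rightarrow> nat \<Rightarrow> ('n, 'k) mpoly" and m n :: nat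
  assumes h: "h \<in> lin_maps poly_ring (free_module poly_ring {..<m}) (free_module poly_ring {..<n})"
begin

lemma lin_maps_vecsD:
  "v \<in> vecs m \<Longrightarrow> h v \<in> vecs n"
  "v \<in> vecs m \<Longrightarrow> w \<in> vecs m \<Longrightarrow> h (v + w) = h v + h w"
  "v \<in> vecs m \<Longrightarrow> h (\<lambda>l. r * v l) = (\<lambda>l. r * h v l)"
  "h 0 = 0"
  using lin_mapsD[OF h, unfolded free_module_vecs]
    lin_maps_zero[OF module_free_module module_free_module h, unfolded free_module_vecs]
  by simp_all

lemma lin_maps_vecs_diff:
  assumes "v \<in> vecs m" "w \<in> vecs m"
  shows "h (v - w) = h v - h w"
  using lin_maps_vecsD(2)[of "v - w" w] assms by (simp add: vecs_closed)

lemma lin_maps_eq_lin: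
  assumes "v \<in> vecs m"
  shows "h v = lin m (\<lambda>j. h (unit_vec j)) v"
proof (rule lin_maps_free_eqI[OF module_free_module h])
  show "lin m (\<lambda>j. h (unit_vec j)) \<in> lin_maps poly_ring (free_module poly_ring {..<m}) (free_module poly_ring {..<n})"
    using lin_maps_vecsD(1)[OF unit_vec_in_vecs]
    by (intro lin_maps_vecsI lin_in_vecs lin_add lin_smult)
  show "v \<in> carrier (free_module poly_ring {..<m})" using assms by (simp only: free_module_vecs)
qed (simp add: lin_unit_vec)

end

lemma lin_maps_lin:
  assumes "\<And>j. j < m \<Longrightarrow> A j \<in> vecs n"
  shows "lin m A \<in> lin_maps poly_ring (free_module poly_ring {..<m}) (free_module poly_ring {..<n})"
  using assms by (intro lin_maps_vecsI lin_in_vecs lin_add lin_smult)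

text \<open>A chain endomorphism lifting the identity of \<open>M\<close> is homotopic to the
  identity: after subtracting the identity and the previous homotopy term, \<open>\<theta>\<close>
  takes values in the cycles, which are boundaries, and freeness allows a linear choice of
  preimages.\<close>

lemma free_resolution_homotopy:
  fixes M :: "(('n, 'k :: field) mpoly, 'm) module" and b :: "nat \<Rightarrow> nat"
  defines "F \<equiv> \<lambda>i. free_module (poly_ring :: ('n, 'k) mpoly ring) {..<b i}"
  assumes F: "resolution poly_ring M F d \<epsilon>"
    and \<theta>: "\<And>i. \<theta> i \<in> lin_maps poly_ring (F i) (F i)"
    and \<theta>0: "\<forall>x\<in>vecs (b 0). \<epsilon> (\<theta> 0 x) = \<epsilon> x"
    and \<theta>d: "\<forall>i. \<forall>x\<in>vecs (b (Suc i)). d i (\<theta> (Suc i) x) = \<theta> i (d i x)"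
  shows "\<exists>h. (\<forall>i. h i \<in> lin_maps poly_ring (F i) (F (Suc i))) \<and>
    (\<forall>x\<in>vecs (b 0). \<theta> 0 x = x + d 0 (h 0 x)) \<and>
    (\<forall>i. \<forall>x\<in>vecs (b (Suc i)). \<theta> (Suc i) x = x + d (Suc i) (h (Suc i) x) + h i (d i x))"
proof -
  note f = resolutionD[OF F]
  have carr: "carrier (F i) = vecs (b i)" "zero (F i) = 0" for i by (simp_all only: F_def free_module_vecs)
  note \<theta>v = lin_maps_vecsD[OF \<theta>[unfolded F_def]] and dv = lin_maps_vecsD[OF f(3)[unfolded F_def]]
  have sum: "summand_of_free poly_ring {..<b i} (F i)" for i
    unfolding F_def by (rule summand_of_free_self)
  have M_eps: "\<epsilon> (v - w) = \<zero>\<^bsub>M\<^esub>" if vw: "v \<in> vecs (b 0)" "w \<in> vecs (b 0)" "\<epsilon> v = \<epsilon> w" for v w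
  proof -
    interpret M: Module.module poly_ring M by (rule f(1))
    have "\<epsilon> v = \<epsilon> (v - w) \<oplus>\<^bsub>M\<^esub> \<epsilon> w"
      using lin_mapsD(2)[OF f(4), of "v - w" w] vw
      by (simp only: F_def free_module_vecs vecs_closed) (simp add: vecs_closed)
    moreover have "\<epsilon> (v - w) \<in> carrier M" "\<epsilon> w \<in> carrier M"
      using lin_mapsD(1)[OF f(4)] vw by (simp_all only: carr vecs_closed)
    ultimately show ?thesis
      using vw(3) M.add.right_cancel[of "\<epsilon> w" "\<epsilon> (v - w)" "\<zero>\<^bsub>M\<^esub>"] by simp
  qed
  \<comment> \<open>The last clause says that the homotopy equation holds after applying
    \<open>d i\<close>, so that the map to be lifted in the next position has values in the
    cycles.\<close>
  define A where "A i h \<longleftrightarrow> h \<in> lin_maps poly_ring (F i) (F (Suc i)) \<and>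
    (i = 0 \<longrightarrow> (\<forall>x\<in>vecs (b 0). \<theta> 0 x = x + d 0 (h x))) \<and>
    (\<forall>x\<in>vecs (b (Suc i)). d i (h (d i x)) = \<theta> i (d i x) - d i x)" for i h
  have "\<exists>h. \<forall>i. A i (h i) \<and> (\<forall>x\<in>vecs (b (Suc i)). \<theta> (Suc i) x = x + d (Suc i) (h (Suc i) x) + h i (d i x))"
  proof (rule dependent_nat_choice)
    have g: "(\<lambda>x. \<theta> 0 x - x) \<in> lin_maps poly_ring (F 0) (F 0)"
      unfolding F_def by (rule lin_maps_vecsI) (auto simp: \<theta>v vecs_closed algebra_simps)
    have "\<theta> 0 x - x \<in> d 0 ` carrier (F (Suc 0))" if "x \<in> carrier (F 0)" for x
      unfolding f(6) using that M_eps \<theta>0 by (simp add: carr \<theta>v vecs_closed)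
    then obtain h where h: "h \<in> lin_maps poly_ring (F 0) (F (Suc 0))" "\<And>x. x \<in> vecs (b 0) \<Longrightarrow> d 0 (h x) = \<theta> 0 x - x"
      using lin_maps_lift[OF f(2) f(2) f(3) sum g] by (auto simp: carr)
    then show "\<exists>h. A 0 h"
      by (intro exI[of _ h]) (auto simp: A_def dv)
  next
    fix h i assume A: "A i h"
    then have hl: "h \<in> lin_maps poly_ring (F i) (F (Suc i))" by (simp add: A_def)
    note hv = lin_maps_vecsD[OF hl[unfolded F_def]]
    let ?g = "\<lambda>x. \<theta> (Suc i) x - x - h (d i x)"
    have g: "?g \<in> lin_maps poly_ring (F (Suc i)) (F (Suc i))"
      unfolding F_def by (rule lin_maps_vecsI) (auto simp: \<theta>v dv hv vecs_closed algebra_simps)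
    have "d i (?g x) = 0" if x: "x \<in> vecs (b (Suc i))" for x
    proof -
      have "d i (?g x) = d i (\<theta> (Suc i) x) - d i x - d i (h (d i x))"
        using x by (simp add: lin_maps_vecs_diff[OF f(3)[unfolded F_def]] \<theta>v dv hv vecs_closed)
      also have "\<dots> = 0" using A x \<theta>d by (simp add: A_def)
      finally show ?thesis .
    qed
    then have "?g x \<in> d (Suc i) ` carrier (F (Suc (Suc i)))" if "x \<in> carrier (F (Suc i))" for x
      unfolding f(7) using that by (simp add: carr \<theta>v dv hv vecs_closed)
    then obtain h' where h': "h' \<in> lin_maps poly_ring (F (Suc i)) (F (Suc (Suc i)))"
      "\<And>x. x \<in> vecs (b (Suc i)) \<Longrightarrow> d (Suc i) (h' x) = ?g x"
      using lin_maps_lift[OF f(2) f(2) f(3) sum g] by (auto simp: carr)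
    have "d (Suc i) (h' (d (Suc i) x)) = \<theta> (Suc i) (d (Suc i) x) - d (Suc i) x" if "x \<in> vecs (b (Suc (Suc i)))" for x
    proof -
      have "d (Suc i) x \<in> {x \<in> carrier (F (Suc i)). d i x = \<zero>\<^bsub>F i\<^esub>}" using that f(7) carr by blast
      then have "d i (d (Suc i) x) = 0" by (simp add: carr)
      then show ?thesis using h'(2) dv(1)[OF that] by (simp add: hv)
    qed
    then show "\<exists>h'. A (Suc i) h' \<and> (\<forall>x\<in>vecs (b (Suc i)). \<theta> (Suc i) x = x + d (Suc i) (h' x) + h (d i x))"
      using h' by (intro exI[of _ h']) (auto simp: A_def)
  qed
  then obtain h where "\<And>i. A i (h i)"
    "\<And>i x. x \<in> vecs (b (Suc i)) \<Longrightarrow> \<theta> (Suc i) x = x + d (Suc i) (h (Suc i) x) + h i (d i x)"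
    by blast
  then show ?thesis by (intro exI[of _ h]) (auto simp: A_def)
qed

text \<open>By minimality both homotopy terms have entries without constant term, so the composite
  from \<open>F\<close> through \<open>P\<close> back to \<open>F\<close> is the identity on
  constant terms.\<close>

lemma minimal_resolution_retract:
  fixes M :: "(('n, 'k :: field) mpoly, 'm) module" and b :: "nat \<Rightarrow> nat"
    and P :: "nat \<Rightarrow> (('n, 'k) mpoly, 'p) module" and X :: "nat \<Rightarrow> 'x set"
  defines "F \<equiv> \<lambda>i. free_module (poly_ring :: ('n, 'k) mpoly ring) {..<b i}"
  assumes F: "resolution poly_ring M F d \<epsilon>"
    and min: "\<forall>i. \<forall>v\<in>vecs (b (Suc i)). \<forall>j<b i. d i v j \<in> irrelevant_ideal"
    and P: "resolution poly_ring M P d' \<epsilon>'"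
    and X: "\<And>i. summand_of_free poly_ring (X i) (P i)"
  shows "\<exists>\<phi> \<psi>. \<phi> \<in> lin_maps poly_ring (F i) (P i) \<and> \<psi> \<in> lin_maps poly_ring (P i) (F i) \<and>
    (\<forall>v\<in>vecs (b i). \<forall>j<b i. Poly_Mapping.lookup (\<psi> (\<phi> v) j) 0 = Poly_Mapping.lookup (v j) 0)"
proof -
  have carr: "carrier (F i) = vecs (b i)" for i by (simp only: F_def free_module_vecs)
  have sum: "summand_of_free poly_ring {..<b i} (F i)" for i
    unfolding F_def by (rule summand_of_free_self)
  obtain \<phi> where \<phi>: "\<And>i. \<phi> i \<in> lin_maps poly_ring (F i) (P i)" "\<And>x. x \<in> vecs (b 0) \<Longrightarrow> \<epsilon>' (\<phi> 0 x) = \<epsilon> x"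
    "\<And>i x. x \<in> vecs (b (Suc i)) \<Longrightarrow> d' i (\<phi> (Suc i) x) = \<phi> i (d i x)"
    using resolution_comparison[OF P F sum] unfolding carr by blast
  obtain \<psi> where \<psi>: "\<And>i. \<psi> i \<in> lin_maps poly_ring (P i) (F i)" "\<And>x. x \<in> carrier (P 0) \<Longrightarrow> \<epsilon> (\<psi> 0 x) = \<epsilon>' x"
    "\<And>i x. x \<in> carrier (P (Suc i)) \<Longrightarrow> d i (\<psi> (Suc i) x) = \<psi> i (d' i x)"
    using resolution_comparison[OF F P X] by blast
  have \<phi>c: "x \<in> vecs (b i) \<Longrightarrow> \<phi> i x \<in> carrier (P i)" for i x
    using lin_mapsD(1)[OF \<phi>(1)] carr by blast
  have \<theta>: "(\<lambda>x. \<psi> i (\<phi> i x)) \<in> lin_maps poly_ring (F i) (F i)" for i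
    using lin_maps_comp[OF \<phi>(1) \<psi>(1)] .
  have \<theta>0: "\<forall>x\<in>vecs (b 0). \<epsilon> (\<psi> 0 (\<phi> 0 x)) = \<epsilon> x"
    using \<phi>(2) \<psi>(2) \<phi>c by simp
  have \<theta>d: "\<forall>i. \<forall>x\<in>vecs (b (Suc i)). d i (\<psi> (Suc i) (\<phi> (Suc i) x)) = \<psi> i (\<phi> i (d i x))"
    using \<phi>(3) \<psi>(3) \<phi>c by simp
  obtain h where h: "\<And>i. h i \<in> lin_maps poly_ring (F i) (F (Suc i))"
    "\<And>x. x \<in> vecs (b 0) \<Longrightarrow> \<psi> 0 (\<phi> 0 x) = x + d 0 (h 0 x)"
    "\<And>i x. x \<in> vecs (b (Suc i)) \<Longrightarrow> \<psi> (Suc i) (\<phi> (Suc i) x) = x + d (Suc i) (h (Suc i) x) + h i (d i x)"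
    using free_resolution_homotopy[OF F[unfolded F_def] \<theta>[unfolded F_def] \<theta>0 \<theta>d]
    unfolding F_def by blast
  have hv: "x \<in> vecs (b i) \<Longrightarrow> h i x \<in> vecs (b (Suc i))" for i x
    using lin_maps_vecsD(1)[OF h(1)[unfolded F_def]] .
  have dv: "x \<in> vecs (b (Suc i)) \<Longrightarrow> d i x \<in> vecs (b i)" for i x
    using lin_maps_vecsD(1)[OF resolutionD(3)[OF F, unfolded F_def]] .
  have d0: "Poly_Mapping.lookup (d i v j) 0 = 0" if "v \<in> vecs (b (Suc i))" "j < b i" for i v j
    using min that by (intro irrelevant_ideal_constant_term) blast
  \<comment> \<open>By linearity the entries of \<open>h i (d i v)\<close> are combinations of the
    entries of \<open>d i v\<close>, none of which has a constant term.\<close>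
  have hd0: "Poly_Mapping.lookup (h i (d i v) j) 0 = 0" if "v \<in> vecs (b (Suc i))" for i v j
  proof -
    have "h i (d i v) j = (\<Sum>k<b i. d i v k * h i (unit_vec k) j)"
      using lin_maps_eq_lin[OF h(1)[unfolded F_def] dv[OF that]] by (simp add: lin_def)
    then show ?thesis by (simp add: lookup_sum lookup_mult_zero d0 that)
  qed
  have "Poly_Mapping.lookup (\<psi> i (\<phi> i v) j) 0 = Poly_Mapping.lookup (v j) 0"
    if "v \<in> vecs (b i)" "j < b i" for v j
    using that by (cases i) (simp_all add: h lookup_add d0 hd0 hv)
  then show ?thesis using \<phi>(1) \<psi>(1) by blast
qed

section \<open>Uniqueness of ranks and a lower bound for the length\<close>

lemma minimal_graded_free_resolutionD:
  assumes "minimal_graded_free_resolution M H b s d \<epsilon>"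
  shows "resolution poly_ring M (\<lambda>i. free_module poly_ring {..<b i}) d \<epsilon>"
    "\<forall>i. \<forall>v\<in>vecs (b (Suc i)). \<forall>j<b i. d i v j \<in> irrelevant_ideal"
  using assms unfolding minimal_graded_free_resolution_def free_module_vecs by blast+

text \<open>The constant terms of the matrices of \<open>\<phi>\<close> and \<open>\<psi>\<close>
  form matrices over the field whose product is the identity of size \<open>b i\<close>.\<close>

lemma minimal_resolution_rank_le:
  fixes M :: "(('n :: finite, 'k :: field) mpoly, 'm) module"
  assumes F: "minimal_graded_free_resolution M H b s d \<epsilon>"
    and F': "minimal_graded_free_resolution M H b' s' d' \<epsilon>'"
  shows "b i \<le> b' i"
proof -
  let ?F = "\<lambda>m :: nat. free_module (poly_ring :: ('n, 'k) mpoly ring) {..<m}"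
  obtain \<phi> \<psi> where \<phi>: "\<phi> \<in> lin_maps poly_ring (?F (b i)) (?F (b' i))"
    and \<psi>: "\<psi> \<in> lin_maps poly_ring (?F (b' i)) (?F (b i))"
    and id: "\<And>v j. v \<in> vecs (b i) \<Longrightarrow> j < b i \<Longrightarrow>
      Poly_Mapping.lookup (\<psi> (\<phi> v) j) 0 = Poly_Mapping.lookup (v j) 0"
    using minimal_resolution_retract[OF minimal_graded_free_resolutionD[OF F]
      minimal_graded_free_resolutionD(1)[OF F'] summand_of_free_self, of i] by blast
  show ?thesis
  proof (rule left_invertible_matrix_bound)
    fix j l assume jl: "j < b i" "l < b i"
    have "\<psi> (\<phi> (unit_vec j)) l = (\<Sum>k<b' i. \<phi> (unit_vec j) k * \<psi> (unit_vec k) l)"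
      using lin_maps_eq_lin[OF \<psi> lin_maps_vecsD(1)[OF \<phi> unit_vec_in_vecs[OF jl(1)]]]
      by (simp add: lin_def)
    then have "(\<Sum>k<b' i. Poly_Mapping.lookup (\<phi> (unit_vec j) k) 0 * Poly_Mapping.lookup (\<psi> (unit_vec k) l) 0) =
        Poly_Mapping.lookup (\<psi> (\<phi> (unit_vec j)) l) 0"
      by (simp add: lookup_sum lookup_mult_zero)
    also have "\<dots> = (if j = l then 1 else 0)"
      using id[OF unit_vec_in_vecs[OF jl(1)] jl(2)] by (simp add: unit_vec_def)
    finally show "(\<Sum>k<b' i. Poly_Mapping.lookup (\<phi> (unit_vec j) k) 0 * Poly_Mapping.lookup (\<psi> (unit_vec k) l) 0) =
        (if j = l then 1 else 0)" .
  qed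
qed

text \<open>The rank bound in both directions gives uniqueness, so any one minimal resolution
  evaluates the definite description in \<open>betti\<close>.\<close>

lemma betti_eqI:
  assumes "minimal_graded_free_resolution M H b s d \<epsilon>"
  shows "betti M H i = b i"
  unfolding betti_def
proof (rule the_equality)
  fix r assume "\<exists>b s d \<epsilon>. minimal_graded_free_resolution M H b s d \<epsilon> \<and> b i = r"
  then obtain b' s' d' \<epsilon>' where r: "minimal_graded_free_resolution M H b' s' d' \<epsilon>'" "b' i = r"
    by blast
  show "r = b i"
    using minimal_resolution_rank_le[OF assms r(1), of i] minimal_resolution_rank_le[OF r(1) assms, of i] r(2)
    by simp
qed (use assms in blast)

text \<open>The constant terms of a vector survive the passage through \<open>P i\<close>; through a
  zero module this is possible only if there are no coordinates.\<close>

lemma minimal_resolution_length_le: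
  fixes M :: "(('n :: finite, 'k :: field) mpoly, 'm) module"
    and P :: "nat \<Rightarrow> (('n, 'k) mpoly, 'p) module"
  assumes F: "minimal_graded_free_resolution M H b s d \<epsilon>"
    and P: "resolution poly_ring M P d' \<epsilon>'" and proj: "\<And>i. projective_module poly_ring (P i)"
    and zero: "carrier (P i) = {\<zero>\<^bsub>P i\<^esub>}"
  shows "b i = 0"
proof (rule ccontr)
  assume "b i \<noteq> 0"
  then have e: "(unit_vec 0 :: nat \<Rightarrow> ('n, 'k) mpoly) \<in> vecs (b i)" by (simp add: unit_vec_in_vecs)
  have "\<exists>X :: 'p set. summand_of_free poly_ring X (P i)" for i
    using proj[of i] unfolding projective_module_def summand_of_free_def by blast
  then obtain X :: "nat \<Rightarrow> 'p set" where X: "\<And>i. summand_of_free poly_ring (X i) (P i)" by metis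
  let ?F = "free_module (poly_ring :: ('n, 'k) mpoly ring) {..<b i}"
  obtain \<phi> \<psi> where \<phi>: "\<phi> \<in> lin_maps poly_ring ?F (P i)" and \<psi>: "\<psi> \<in> lin_maps poly_ring (P i) ?F"
    and id: "\<And>v j. v \<in> vecs (b i) \<Longrightarrow> j < b i \<Longrightarrow>
      Poly_Mapping.lookup (\<psi> (\<phi> v) j) 0 = Poly_Mapping.lookup (v j) 0"
    using minimal_resolution_retract[OF minimal_graded_free_resolutionD[OF F] P X, of i] by blast
  have "\<phi> (unit_vec 0) = \<zero>\<^bsub>P i\<^esub>"
    using lin_mapsD(1)[OF \<phi>, unfolded free_module_vecs, OF e] zero by simp
  then have "\<psi> (\<phi> (unit_vec 0)) = 0"
    using lin_maps_zero[OF resolutionD(2)[OF P] module_free_module \<psi>] by (simp add: fun_eq_iff)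
  then show False
    using id[OF e, of 0] \<open>b i \<noteq> 0\<close> by (simp add: unit_vec_def)
qed

section \<open>The dual of a strongly stable ideal\<close>

lemma mon_dvd_iff: "mon_dvd f g \<longleftrightarrow> (\<forall>i. Poly_Mapping.lookup f i \<le> Poly_Mapping.lookup g i)"
proof
  assume "\<forall>i. Poly_Mapping.lookup f i \<le> Poly_Mapping.lookup g i"
  then have "g = f + (g - f)" by (intro poly_mapping_eqI) (simp add: lookup_add lookup_minus)
  then show "mon_dvd f g" unfolding mon_dvd_def by blast
qed (auto simp: mon_dvd_def lookup_add)

lemma mon_dvd_single_iff: "mon_dvd (Poly_Mapping.single i 1) m \<longleftrightarrow> Poly_Mapping.lookup m i \<noteq> 0"
  by (auto simp: mon_dvd_iff lookup_single when_def)

lemma monomial_span_zero: "0 \<in> monomial_span T"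
  by (simp add: monomial_span_def)

lemma monomial_span_add: "p \<in> monomial_span T \<Longrightarrow> q \<in> monomial_span T \<Longrightarrow> p + q \<in> monomial_span T"
  using keys_add[of p q] by (auto simp: monomial_span_def)

lemma monomial_span_mult: "p \<in> monomial_span T \<Longrightarrow> q * p \<in> monomial_span T"
  using keys_mult_dvd[of p T _ q] unfolding monomial_span_def by (auto simp: mult.commute)

lemma monomial_span_sum: "(\<And>j. j \<in> S \<Longrightarrow> f j \<in> monomial_span T) \<Longrightarrow> sum f S \<in> monomial_span T"
  by (induction S rule: infinite_finite_induct) (auto intro: monomial_span_add monomial_span_zero)

lemma monomial_span_empty: "monomial_span {} = {0}"
  by (auto simp: monomial_span_def)

text \<open>Matches the ideal produced by \<open>lin_res_cone\<close> with adjoining one monomial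
  generator: each term of a polynomial is a multiple of \<open>xpow w\<close> or already lies in the
  span of \<open>T\<close>.\<close>

lemma monomial_span_insert:
  "monomial_span (insert w T) =
    {p + q * xpow w | p q. p \<in> (monomial_span T :: ('n, 'k :: field) mpoly set)}" (is "_ = ?S")
proof
  have "xpow w \<in> (monomial_span (insert w T) :: ('n, 'k) mpoly set)"
    by (auto simp: monomial_span_def xpow_def mon_dvd_iff)
  moreover have "monomial_span T \<subseteq> (monomial_span (insert w T) :: ('n, 'k) mpoly set)"
    by (auto simp: monomial_span_def)
  ultimately show "?S \<subseteq> monomial_span (insert w T)"
    by (auto intro!: monomial_span_add monomial_span_mult)
  have zero: "0 \<in> ?S" by (rule CollectI, rule exI[of _ 0], rule exI[of _ 0]) (simp add: monomial_span_zero)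
  have add: "x + y \<in> ?S" if xy: "x \<in> ?S" "y \<in> ?S" for x y
  proof -
    obtain p q p' q' where "x = p + q * xpow w" "y = p' + q' * xpow w"
      "p \<in> monomial_span T" "p' \<in> monomial_span T" using xy by blast
    then have "x + y = (p + p') + (q + q') * xpow w" "p + p' \<in> monomial_span T"
      by (simp_all add: algebra_simps monomial_span_add)
    then show ?thesis by blast
  qed
  have sum: "sum f S \<in> ?S" if "\<And>m. m \<in> S \<Longrightarrow> f m \<in> ?S" for S and f :: "('n \<Rightarrow>\<^sub>0 nat) \<Rightarrow> ('n, 'k) mpoly"
    using that
  proof (induction S rule: infinite_finite_induct)
    case (insert m S)
    have "f m + sum f S \<in> ?S" by (rule add) (use insert in \<open>blast+\<close>)
    then show ?case by (simp only: sum.insert[OF insert.hyps])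
  qed (use zero in simp_all)
  show "monomial_span (insert w T) \<subseteq> ?S"
  proof
    fix p :: "('n, 'k) mpoly" assume p: "p \<in> monomial_span (insert w T)"
    have "Poly_Mapping.single m c \<in> ?S" if m: "m \<in> Poly_Mapping.keys p" for m and c :: 'k
    proof -
      consider "mon_dvd w m" | t where "t \<in> T" "mon_dvd t m"
        using p m by (auto simp: monomial_span_def)
      then show ?thesis
      proof cases
        case 1
        then obtain h where "m = w + h" by (auto simp: mon_dvd_def)
        then have "Poly_Mapping.single m c = 0 + Poly_Mapping.single h c * xpow w"
          by (simp add: xpow_def mult_single add.commute)
        then show ?thesis using monomial_span_zero by blast
      next
        case 2
        then have "Poly_Mapping.single m c \<in> (monomial_span T :: ('n, 'k) mpoly set)"
          by (auto simp: monomial_span_def)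
        moreover have "Poly_Mapping.single m c = Poly_Mapping.single m c + 0 * xpow w" by simp
        ultimately show ?thesis by blast
      qed
    qed
    then show "p \<in> ?S" by (subst poly_mapping_sum_single[of p]) (rule sum)
  qed
qed

text \<open>Translation by \<open>w\<close> is injective, so no terms cancel. This makes colon
  ideals by a monomial computable on supports.\<close>

lemma keys_mult_xpow: "Poly_Mapping.keys (p * xpow w) = (\<lambda>m. m + w) ` Poly_Mapping.keys (p :: ('n, 'k :: field) mpoly)"
proof -
  have "p * xpow w = (\<Sum>m\<in>Poly_Mapping.keys p. Poly_Mapping.single (m + w) (Poly_Mapping.lookup p m))"
    by (subst poly_mapping_sum_single[of p]) (simp add: sum_distrib_right xpow_def mult_single)
  then have l: "Poly_Mapping.lookup (p * xpow w) k =
      (\<Sum>m\<in>Poly_Mapping.keys p. if m + w = k then Poly_Mapping.lookup p m else 0)" for k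
    by (simp add: lookup_sum lookup_single when_def)
  have l': "Poly_Mapping.lookup (p * xpow w) (m + w) = Poly_Mapping.lookup p m" for m
    by (auto simp: l in_keys_iff)
  have "Poly_Mapping.keys (p * xpow w) \<subseteq> range (\<lambda>m. m + w)"
  proof
    fix k assume "k \<in> Poly_Mapping.keys (p * xpow w)"
    then have "(\<Sum>m\<in>Poly_Mapping.keys p. if m + w = k then Poly_Mapping.lookup p m else 0) \<noteq> 0"
      by (simp only: in_keys_iff l not_False_eq_True)
    then obtain m where "(if m + w = k then Poly_Mapping.lookup p m else 0) \<noteq> 0"
      by (rule sum.not_neutral_contains_not_neutral)
    then show "k \<in> range (\<lambda>m. m + w)" by (auto split: if_splits)
  qed
  then show ?thesis using l' by (auto simp: in_keys_iff)
qed

lemma xpow_homogeneous: "xpow w \<in> homogeneous_of (int (mon_deg w))"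
  by (simp add: homogeneous_of_def xpow_def)

lemma mon_deg_single: "mon_deg (Poly_Mapping.single i c) = c"
  by (simp add: mon_deg_def lookup_single when_def)

section \<open>The Koszul complex on a set of variables\<close>

lemma lin_res_variables:
  fixes S :: "'n :: finite set"
  shows "\<exists>A. lin_res (monomial_span ((\<lambda>i. Poly_Mapping.single i 1) ` S) :: ('n, 'k :: field) mpoly set)
    1 (\<lambda>i. card S choose i) A"
proof (induction S rule: finite_induct[OF finite])
  case 1
  have "(\<lambda>i. card ({} :: 'n set) choose i) = (\<lambda>i. if i = 0 then 1 else 0)" by (auto simp: fun_eq_iff)
  then show ?case using lin_res_zero[where ?'n = 'n and ?'k = 'k] by (auto simp: monomial_span_empty)
next
  case (2 t S)
  let ?I = "\<lambda>S. monomial_span ((\<lambda>i. Poly_Mapping.single i 1) ` S) :: ('n, 'k) mpoly set"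
  let ?u = "xpow (Poly_Mapping.single t 1) :: ('n, 'k) mpoly"
  obtain A where A: "lin_res (?I S) 1 (\<lambda>i. card S choose i) A" using 2 by blast
  have u: "?u \<in> homogeneous_of 1"
    using xpow_homogeneous[of "Poly_Mapping.single t 1", where 'b = 'k] by (simp add: mon_deg_single)
  \<comment> \<open>As \<open>t\<close> is not in \<open>S\<close>, multiplying by the variable with
    index \<open>t\<close> does not affect divisibility by the variables in \<open>S\<close>; hence
    the colon ideal is unchanged.\<close>
  have "(\<exists>s\<in>(\<lambda>i. Poly_Mapping.single i 1) ` S. mon_dvd s (m + Poly_Mapping.single t 1)) \<longleftrightarrow>
      (\<exists>s\<in>(\<lambda>i. Poly_Mapping.single i 1) ` S. mon_dvd s m)" for m
    using \<open>t \<notin> S\<close> by (auto simp: mon_dvd_single_iff[simplified] lookup_add lookup_single when_def)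
  then have colon: "?I S = {p. p * ?u \<in> ?I S}"
    by (simp add: keys_mult_xpow monomial_span_def)
  \<comment> \<open>Pascal's rule.\<close>
  have "(\<lambda>i. (card S choose i) + (case i of 0 \<Rightarrow> 0 | Suc i' \<Rightarrow> card S choose i')) =
      (\<lambda>i. card (insert t S) choose i)"
    using 2 by (auto simp: fun_eq_iff split: nat.split)
  then show ?case
    using lin_res_cone[OF A A u colon] by (simp add: monomial_span_insert)
qed

section \<open>From the quotient to the ideal: minimal graded resolutions\<close>

lemma module_ideal_module:
  fixes I :: "('n, 'k :: field) mpoly set"
  assumes "ideal I poly_ring"
  shows "Module.module poly_ring (ideal_module I)"
proof -
  interpret I: ideal I poly_ring by fact
  have m: "p + q \<in> I" if "p \<in> I" "q \<in> I" for p q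
    using additive_subgroup.a_closed[OF I.is_additive_subgroup that] by simp
  have m': "r * p \<in> I" "- p \<in> I" if "p \<in> I" for p r
    using I.I_l_closed[of p r] I.I_l_closed[of p "-1"] that by simp_all
  have "0 \<in> I" using additive_subgroup.zero_closed[OF I.is_additive_subgroup] by simp
  then show ?thesis
    using m m'
    by (intro Module.moduleI abelian_groupI cring_poly_ring)
      (auto simp: ideal_module_def distrib_left distrib_right add.assoc add.commute add.left_commute
        mult.assoc intro: bexI[of _ "- _"])
qed

text \<open>Position \<open>0\<close> is cut off and the coordinate of \<open>A 0\<close> becomes
  the augmentation. The remaining differentials have linear entries, which lie in the irrelevant
  ideal and raise the generator degree by one per position, whence the shifts
  \<open>D + int i\<close>.\<close>

lemma lin_res_minimal_resolution:
  fixes I :: "('n :: finite, 'k :: field) mpoly set"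
  assumes res: "lin_res I D g A" and I: "ideal I poly_ring"
  shows "\<exists>d \<epsilon>. minimal_graded_free_resolution (ideal_module I) (\<lambda>t. I \<inter> homogeneous_of t)
    (\<lambda>i. g (Suc i)) (\<lambda>i j. D + int i) d \<epsilon>"
proof -
  define d where "d i = lin (g (Suc (Suc i))) (A (Suc i))" for i
  define \<epsilon> where "\<epsilon> v = lin (g 1) (A 0) v 0" for v
  have Av: "A i j \<in> vecs (g i)" if "j < g (Suc i)" for i j
    using res that by (simp add: lin_res_def)
  have Ah: "A i j l \<in> homogeneous_of (if i = 0 then D else 1)" if "j < g (Suc i)" for i j l
    using res that by (simp add: lin_res_def)
  have g0: "g 0 = 1" using res by (simp add: lin_res_def)
  have im: "lin (g 1) (A 0) ` vecs (g 1) = {v \<in> vecs 1. v 0 \<in> I}"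
    using res by (simp add: lin_res_def)
  have ex: "d i ` vecs (g (Suc (Suc i))) = {v \<in> vecs (g (Suc i)). lin (g (Suc i)) (A i) v = 0}" for i
    using res by (simp add: lin_res_def d_def)
  \<comment> \<open>Vectors of length one are determined by coordinate \<open>0\<close>, so
    exactness for \<open>A 0\<close> carries over to \<open>\<epsilon>\<close>.\<close>
  have ker: "lin (g 1) (A 0) v = 0 \<longleftrightarrow> \<epsilon> v = 0" for v
  proof -
    have "lin (g 1) (A 0) v \<in> vecs 1" using Av[of _ 0] g0 by (intro lin_in_vecs) simp
    then have "lin (g 1) (A 0) v l = 0" if "l \<noteq> 0" for l using that by (simp add: vecs_def)
    then show ?thesis unfolding \<epsilon>_def fun_eq_iff by (metis zero_fun_apply)
  qed
  have dl: "d i \<in> lin_maps poly_ring (free_module poly_ring {..<g (Suc (Suc i))}) (free_module poly_ring {..<g (Suc i)})" for i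
    unfolding d_def using Av by (intro lin_maps_lin) simp
  have \<epsilon>I: "\<epsilon> ` vecs (g 1) = I"
  proof (intro equalityI subsetI)
    fix p assume "p \<in> I"
    then have "(\<lambda>l. if l = 0 then p else 0) \<in> {v \<in> vecs 1. v 0 \<in> I}" by (simp add: vecs_def)
    then obtain v where "v \<in> vecs (g 1)" "(\<lambda>l. if l = 0 then p else 0) = lin (g 1) (A 0) v"
      unfolding im[symmetric] by blast
    then have "v \<in> vecs (g 1)" "p = \<epsilon> v" unfolding \<epsilon>_def by (auto dest: fun_cong[of _ _ 0])
    then show "p \<in> \<epsilon> ` vecs (g 1)" by blast
  qed (use im in \<open>auto simp: \<epsilon>_def\<close>)
  have \<epsilon>l: "\<epsilon> \<in> lin_maps poly_ring (free_module poly_ring {..<g 1}) (ideal_module I)"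
  proof (rule lin_mapsI)
    fix v :: "nat \<Rightarrow> ('n, 'k) mpoly" assume "v \<in> carrier (free_module poly_ring {..<g 1})"
    then show "\<epsilon> v \<in> carrier (ideal_module I)"
      using \<epsilon>I unfolding free_module_vecs by (auto simp: ideal_module_def)
  qed (simp_all only: free_module_vecs \<epsilon>_def lin_add lin_smult, simp_all add: ideal_module_def)
  have "resolution poly_ring (ideal_module I) (\<lambda>i. free_module poly_ring {..<g (Suc i)}) d \<epsilon>"
    unfolding resolution_def free_module_vecs
  proof (intro conjI allI)
    show "\<epsilon> ` vecs (g (Suc 0)) = carrier (ideal_module I)"
      using \<epsilon>I by (simp add: ideal_module_def)
    show "d 0 ` vecs (g (Suc 1)) = {x \<in> vecs (g (Suc 0)). \<epsilon> x = \<zero>\<^bsub>ideal_module I\<^esub>}"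
      using ex[of 0] ker by (simp add: ideal_module_def)
    show "d (Suc i) ` vecs (g (Suc (Suc (Suc i)))) = {x \<in> vecs (g (Suc (Suc i))). d i x = 0}" for i
      using ex[of "Suc i"] by (simp add: d_def)
  qed (use dl \<epsilon>l module_ideal_module[OF I] module_free_module in simp_all)
  moreover have "d i v j \<in> irrelevant_ideal" for i v j
  proof -
    have "A (Suc i) k j \<in> irrelevant_ideal" if "k < g (Suc (Suc i))" for k
      using Ah[OF that, of j] by (intro homogeneous_of_one_irrelevant) simp
    then show ?thesis
      unfolding d_def lin_def irrelevant_ideal_eq by (intro monomial_span_sum monomial_span_mult) simp
  qed
  moreover have "d i v \<in> free_component (g (Suc i)) (\<lambda>_. D + int i) t"
    if v: "v \<in> free_component (g (Suc (Suc i))) (\<lambda>_. D + int (Suc i)) t" for i v t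
  proof -
    have "v \<in> vecs (g (Suc (Suc i)))" using v unfolding free_component_def free_module_vecs by blast
    then have "d i v \<in> vecs (g (Suc i))" using lin_maps_vecsD(1)[OF dl] by blast
    moreover have "d i v l \<in> homogeneous_of ((t - (D + int (Suc i))) + 1)" for l
      unfolding d_def using v Ah[of _ "Suc i"] by (intro homogeneous_of_lin) (auto simp: free_component_def)
    ultimately show ?thesis unfolding free_component_def free_module_vecs by (simp add: algebra_simps)
  qed
  moreover have "\<epsilon> v \<in> I \<inter> homogeneous_of t" if v: "v \<in> free_component (g (Suc 0)) (\<lambda>_. D + int 0) t" for v t
  proof
    have "v \<in> vecs (g 1)" using v unfolding free_component_def free_module_vecs by simp
    then show "\<epsilon> v \<in> I" using \<epsilon>I by blast
    have "\<epsilon> v \<in> homogeneous_of ((t - D) + D)"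
      unfolding \<epsilon>_def using v Ah[of _ 0] by (intro homogeneous_of_lin) (auto simp: free_component_def)
    then show "\<epsilon> v \<in> homogeneous_of t" by simp
  qed
  ultimately have "minimal_graded_free_resolution (ideal_module I) (\<lambda>t. I \<inter> homogeneous_of t)
    (\<lambda>i. g (Suc i)) (\<lambda>i j. D + int i) d \<epsilon>"
    unfolding minimal_graded_free_resolution_def by blast
  then show ?thesis by blast
qed

section \<open>Generators of the dual and their colon ideals\<close>

context
  fixes a :: "'n :: {finite, linorder} \<Rightarrow>\<^sub>0 nat"
    and I :: "('n, 'k :: field) mpoly set"
    and d :: nat
  assumes mon: "monomial_ideal I" and det: "determined_by a I"
    and stable: "strongly_stable I" and gen: "generated_in_degree d I"
begin

lemma min_gens_le: "f \<in> min_gens I \<Longrightarrow> Poly_Mapping.lookup f i \<le> Poly_Mapping.lookup a i"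
  using det by (auto simp: determined_by_def mon_dvd_iff)

lemma min_gens_deg: "f \<in> min_gens I \<Longrightarrow> mon_deg f = d"
  using gen by (auto simp: generated_in_degree_def)

lemma finite_min_gens: "finite (min_gens I)"
proof -
  have "Poly_Mapping.lookup ` min_gens I \<subseteq> Pi\<^sub>E UNIV (\<lambda>i. {..Poly_Mapping.lookup a i})"
    using min_gens_le by (auto simp: PiE_def)
  then have "finite (Poly_Mapping.lookup ` min_gens I)"
    by (rule finite_subset) (intro finite_PiE; simp)
  then show ?thesis
    by (rule finite_imageD) (auto simp: inj_on_def intro: poly_mapping_eqI)
qed

text \<open>Strong stability puts b x_1/x_i into \<open>I\<close>. A minimal generator dividing this
  monomial has the same degree, because all generators have degree \<open>d\<close>, and is
  therefore equal to it.\<close>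

lemma min_gens_exchange:
  assumes b: "b \<in> min_gens I" and i: "i \<in> supp1 b"
  shows "b + Poly_Mapping.single (Min UNIV) 1 - Poly_Mapping.single i 1 \<in> min_gens I" (is "?f \<in> _")
    and "b < b + Poly_Mapping.single (Min UNIV) 1 - Poly_Mapping.single i 1"
proof -
  let ?o = "Min UNIV :: 'n"
  have oi: "?o < i" and bi: "Poly_Mapping.lookup b i \<noteq> 0"
    using i by (simp_all add: supp1_def mon_dvd_single_iff[simplified])
  have I: "xpow m \<in> I \<longleftrightarrow> (\<exists>f\<in>min_gens I. mon_dvd f m)" for m
    using min_gens_monomial_ideal(1)[OF mon] xpow_mem_Idl_iff by metis
  have refl: "mon_dvd m m" for m :: "'n \<Rightarrow>\<^sub>0 nat" by (simp add: mon_dvd_iff)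
  have "xpow b \<in> I" using b I refl by blast
  moreover have "mon_dvd (Poly_Mapping.single i 1) b" using bi by (simp add: mon_dvd_single_iff[simplified])
  ultimately have "xpow ?f \<in> I" using stable oi unfolding strongly_stable_def by blast
  then obtain g where g: "g \<in> min_gens I" "mon_dvd g ?f" using I by blast
  then obtain h where h: "?f = g + h" by (auto simp: mon_dvd_def)
  have f: "?f + Poly_Mapping.single i 1 = b + Poly_Mapping.single ?o 1"
    using bi by (intro poly_mapping_eqI) (auto simp: lookup_add lookup_minus lookup_single when_def)
  have "mon_deg ?f + 1 = mon_deg b + 1"
    using arg_cong[OF f, of mon_deg] by (simp add: mon_deg_add mon_deg_single)
  then have "mon_deg h = 0"
    using h min_gens_deg[OF b] min_gens_deg[OF g(1)] by (simp add: mon_deg_add)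
  then have "h = 0" by (intro poly_mapping_eqI) (simp add: mon_deg_def)
  then show "?f \<in> min_gens I" using g h by simp
  \<comment> \<open>The order on exponent vectors is lexicographic with the least index most
    significant, and the exponent of x_1 has grown.\<close>
  show "b < ?f"
    unfolding less_poly_mapping.rep_eq less_fun_def
    by (rule exI[of _ ?o])
      (use oi in \<open>auto simp: lookup_add lookup_minus lookup_single when_def\<close>)
qed

text \<open>At the first index where they differ, \<open>f\<close> has the larger exponent. Equality
  of degrees forces a smaller exponent elsewhere, which can only be at a later index, hence not at
  x_1.\<close>

lemma larger_min_gen:
  assumes b: "b \<in> min_gens I" and f: "f \<in> min_gens I" "b < f"
  shows "\<exists>i\<in>supp1 b. Poly_Mapping.lookup f i < Poly_Mapping.lookup b i"
proof -
  obtain k where k: "Poly_Mapping.lookup b k < Poly_Mapping.lookup f k"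
    "\<And>k'. k' < k \<Longrightarrow> Poly_Mapping.lookup b k' = Poly_Mapping.lookup f k'"
    using f(2) unfolding less_poly_mapping.rep_eq by (auto simp: less_fun_def)
  have "\<exists>i. Poly_Mapping.lookup f i < Poly_Mapping.lookup b i"
  proof (rule ccontr)
    assume "\<not> ?thesis"
    then have "mon_deg b < mon_deg f"
      unfolding mon_deg_def using k(1) by (intro sum_strict_mono_ex1) (auto simp: not_less)
    then show False using min_gens_deg b f by simp
  qed
  then obtain i where i: "Poly_Mapping.lookup f i < Poly_Mapping.lookup b i" by blast
  then have "k < i" using k by (cases k i rule: linorder_cases) auto
  then have "Min UNIV < i" by (meson Min_le UNIV_I finite le_less_trans)
  then show ?thesis using i by (auto simp: supp1_def mon_dvd_single_iff[simplified])
qed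

text \<open>The set \<open>A\<close> consists of all generators larger than \<open>b\<close>. For i
  in \<open>supp1 b\<close>, the generator f = b x_1/x_i lies in \<open>A\<close>, and x^a/f divides
  x_i x^a/b. Conversely, by \<open>larger_min_gen\<close>, each x^a/f with f in \<open>A\<close> has
  at some i in \<open>supp1 b\<close> a larger exponent than x^a/b, so a cofactor must contain
  x_i.\<close>

lemma dual_colon:
  assumes b: "b \<in> min_gens I" and A: "A \<subseteq> min_gens I" "\<forall>f\<in>A. b < f" "\<forall>g\<in>min_gens I. b < g \<longrightarrow> g \<in> A"
  shows "(monomial_span ((\<lambda>i. Poly_Mapping.single i 1) ` supp1 b) :: ('n, 'k) mpoly set) =
    {p. p * xpow (a - b) \<in> monomial_span ((\<lambda>f. a - f) ` A)}"
proof -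
  have "(\<exists>i\<in>supp1 b. Poly_Mapping.lookup m i \<noteq> 0) \<longleftrightarrow> (\<exists>f\<in>A. mon_dvd (a - f) (m + (a - b)))" for m
  proof
    assume "\<exists>i\<in>supp1 b. Poly_Mapping.lookup m i \<noteq> 0"
    then obtain i where i: "i \<in> supp1 b" "Poly_Mapping.lookup m i \<noteq> 0" by blast
    let ?f = "b + Poly_Mapping.single (Min UNIV) 1 - Poly_Mapping.single i 1"
    have "?f \<in> A" using min_gens_exchange[OF b i(1)] A by blast
    moreover have "mon_dvd (a - ?f) (m + (a - b))"
      using i(2) by (auto simp: mon_dvd_iff lookup_add lookup_minus lookup_single when_def)
    ultimately show "\<exists>f\<in>A. mon_dvd (a - f) (m + (a - b))" by blast
  next
    assume "\<exists>f\<in>A. mon_dvd (a - f) (m + (a - b))"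
    then obtain f where f: "f \<in> A" "mon_dvd (a - f) (m + (a - b))" by blast
    then obtain i where i: "i \<in> supp1 b" "Poly_Mapping.lookup f i < Poly_Mapping.lookup b i"
      using larger_min_gen[OF b] A by blast
    have "Poly_Mapping.lookup a i - Poly_Mapping.lookup f i \<le>
        Poly_Mapping.lookup m i + (Poly_Mapping.lookup a i - Poly_Mapping.lookup b i)"
      using f(2) by (simp add: mon_dvd_iff lookup_add lookup_minus)
    \<comment> \<open>The exponents of \<open>b\<close> are bounded by those of \<open>a\<close>, so
      the subtraction on the right-hand side is not truncated.\<close>
    then have "Poly_Mapping.lookup m i \<noteq> 0" using i(2) min_gens_le[OF b, of i] by linarith
    then show "\<exists>i\<in>supp1 b. Poly_Mapping.lookup m i \<noteq> 0" using i(1) by blast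
  qed
  then show ?thesis
    by (simp add: keys_mult_xpow monomial_span_def mon_dvd_single_iff[simplified])
qed

text \<open>The generators x^a/f share the degree \<open>mon_deg a - d\<close>, so each cone stays
  linear. The ranks are \<open>1\<close> in position \<open>0\<close> and sums of shifted Koszul
  ranks above it.\<close>

lemma lin_res_dual_ideal:
  "\<exists>C. lin_res (dual_ideal a I) (int (mon_deg a) - int d)
    (\<lambda>i. case i of 0 \<Rightarrow> 1 | Suc i' \<Rightarrow> \<Sum>f\<in>min_gens I. card (supp1 f) choose i') C"
proof -
  let ?J = "\<lambda>A. monomial_span ((\<lambda>f. a - f) ` A) :: ('n, 'k) mpoly set"
  let ?D = "int (mon_deg a) - int d"
  let ?g = "\<lambda>A i. case i of 0 \<Rightarrow> 1 | Suc i' \<Rightarrow> \<Sum>f\<in>A. card (supp1 f) choose i'"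
  \<comment> \<open>Induction over the sets of generators that are closed under passing to larger
    ones; each step inserts an element \<open>b\<close> below all earlier ones.\<close>
  have "A \<subseteq> min_gens I \<longrightarrow> (\<forall>f\<in>A. \<forall>g\<in>min_gens I. f < g \<longrightarrow> g \<in> A) \<longrightarrow> (\<exists>C. lin_res (?J A) ?D (?g A) C)"
    if "finite A" for A
    using that
  proof (induction A rule: finite_linorder_min_induct)
    case empty
    have *: "?g {} = (\<lambda>i. if i = 0 then 1 else 0)" by (auto simp: fun_eq_iff split: nat.split)
    have "lin_res (?J {}) ?D (?g {}) (\<lambda>_ _. 0)"
      unfolding * using lin_res_zero by (simp add: monomial_span_empty)
    then show ?case by blast
  next
    case (insert b A)
    show ?case
    proof (intro impI)
      assume sub: "insert b A \<subseteq> min_gens I"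
        and up: "\<forall>f\<in>insert b A. \<forall>g\<in>min_gens I. f < g \<longrightarrow> g \<in> insert b A"
      have b: "b \<in> min_gens I" using sub by blast
      \<comment> \<open>Upward closure of the new set shows that \<open>A\<close> already contains
        every generator larger than \<open>b\<close>, as \<open>dual_colon\<close> requires.\<close>
      have up': "\<forall>g\<in>min_gens I. b < g \<longrightarrow> g \<in> A" using up by auto
      have "\<forall>f\<in>A. \<forall>g\<in>min_gens I. f < g \<longrightarrow> g \<in> A" using up' insert.hyps(2) by (meson less_trans)
      then obtain C where C: "lin_res (?J A) ?D (?g A) C" using insert.IH sub by blast
      obtain K where K: "lin_res (monomial_span ((\<lambda>i. Poly_Mapping.single i 1) ` supp1 b) :: ('n, 'k) mpoly set)
          1 (\<lambda>i. card (supp1 b) choose i) K"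
        using lin_res_variables by blast
      have "(a - b) + b = a"
        using min_gens_le[OF b] by (intro poly_mapping_eqI) (simp add: lookup_add lookup_minus)
      then have "mon_deg (a - b) + d = mon_deg a" using mon_deg_add min_gens_deg[OF b] by metis
      then have u: "(xpow (a - b) :: ('n, 'k) mpoly) \<in> homogeneous_of ?D"
        using xpow_homogeneous[of "a - b"] by (metis add_diff_cancel_right' of_nat_add)
      have "b \<notin> A" using insert.hyps by blast
      \<comment> \<open>The cone adds the Koszul ranks of \<open>supp1 b\<close> shifted up by one
        position and leaves the rank in position \<open>0\<close> at \<open>1\<close>.\<close>
      then have g_eq: "(\<lambda>i. ?g A i + (case i of 0 \<Rightarrow> 0 | Suc i' \<Rightarrow> card (supp1 b) choose i')) = ?g (insert b A)"
        using insert.hyps(1) by (auto simp: fun_eq_iff split: nat.split)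
      have "A \<subseteq> min_gens I" using sub by blast
      then show "\<exists>C. lin_res (?J (insert b A)) ?D (?g (insert b A)) C"
        using lin_res_cone[OF C K u dual_colon[OF b _ insert.hyps(2) up']]
        unfolding g_eq image_insert monomial_span_insert by blast
    qed
  qed
  moreover have "dual_ideal a I = ?J (min_gens I)"
    unfolding dual_ideal_def Idl_xpow by (simp add: setcompr_eq_image)
  ultimately show ?thesis using finite_min_gens by auto
qed

end

section \<open>Projective dimension\<close>

text \<open>\<^const>\<open>proj_dim\<close> only sees resolutions by modules of lists, so free modules of finite rank are
  copied there.\<close>

definition enc_vec :: "nat \<Rightarrow> (nat \<Rightarrow> 'r) \<Rightarrow> ('r \<times> 'm) list"
  where "enc_vec b v = map (\<lambda>j. (v j, undefined)) [0..<b]"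

definition dec_vec :: "('r :: zero \<times> 'm) list \<Rightarrow> nat \<Rightarrow> 'r"
  where "dec_vec xs = (\<lambda>j. if j < length xs then fst (xs ! j) else 0)"

lemma dec_enc_vec: "v \<in> vecs b \<Longrightarrow> dec_vec (enc_vec b v) = v"
  by (auto simp: dec_vec_def enc_vec_def vecs_def)

definition list_module :: "nat \<Rightarrow> ('r :: comm_ring_1, ('r \<times> 'm) list) module"
  where "list_module b =
    \<lparr>carrier = enc_vec b ` vecs b, mult = undefined, one = undefined, zero = enc_vec b 0,
     add = (\<lambda>x y. enc_vec b (dec_vec x + dec_vec y)),
     smult = (\<lambda>r x. enc_vec b (\<lambda>l. r * dec_vec x l))\<rparr>"

lemma enc_vec_lin: "enc_vec b \<in> lin_maps poly_ring (free_module poly_ring {..<b}) (list_module b)"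
  by (rule lin_mapsI) (simp_all only: free_module_vecs, simp_all add: list_module_def dec_enc_vec)

lemma dec_vec_lin: "dec_vec \<in> lin_maps poly_ring (list_module b) (free_module poly_ring {..<b})"
  by (rule lin_mapsI)
    (simp_all only: free_module_vecs, auto simp: list_module_def dec_enc_vec vecs_closed)

lemma module_list_module: "Module.module poly_ring (list_module b :: (('n, 'k :: field) mpoly, _) module)"
proof (intro Module.moduleI abelian_groupI cring_poly_ring)
  fix x :: "(('n, 'k) mpoly \<times> 'a) list" assume "x \<in> carrier (list_module b)"
  then obtain v where v: "v \<in> vecs b" "x = enc_vec b v" by (auto simp: list_module_def)
  then show "\<exists>y\<in>carrier (list_module b). y \<oplus>\<^bsub>list_module b\<^esub> x = \<zero>\<^bsub>list_module b\<^esub>"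
    by (intro bexI[of _ "enc_vec b (- v)"]) (auto simp: list_module_def dec_enc_vec vecs_closed)
qed (auto simp: list_module_def dec_enc_vec vecs_closed algebra_simps intro!: arg_cong[of _ _ "enc_vec b"])

text \<open>The module is free, but \<open>projective_module\<close> wants a basis inside the type
  of its elements, so suitable lists are used as labels of the coordinates.\<close>

lemma projective_list_module:
  "projective_module poly_ring (list_module b :: (('n, 'k :: field) mpoly, (('n, 'k) mpoly \<times> 'm) list) module)"
proof -
  let ?L = "list_module b :: (('n, 'k) mpoly, (('n, 'k) mpoly \<times> 'm) list) module"
  \<comment> \<open>The label of coordinate \<open>j\<close> is some list of length
    \<open>j\<close>; its length recovers the index.\<close>
  define e where "e j = replicate j (0 :: ('n, 'k) mpoly, undefined :: 'm)" for j
  define X where "X = e ` {..<b}"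
  define s where "s x = (\<lambda>y. if y \<in> X then dec_vec x (length y) else 0)" for x :: "(('n, 'k) mpoly \<times> 'm) list"
  define p where "p f = (enc_vec b (\<lambda>j. if j < b then f (e j) else 0) :: (('n, 'k) mpoly \<times> 'm) list)" for f
  have "finite X" by (simp add: X_def)
  have e: "length (e j) = j" "e j \<in> X \<longleftrightarrow> j < b" for j
    by (auto simp: e_def X_def)
  have s: "s \<in> lin_maps poly_ring ?L (free_module poly_ring X)"
  proof (rule lin_mapsI)
    fix x assume "x \<in> carrier ?L"
    show "s x \<in> carrier (free_module poly_ring X)"
      using finite_subset[OF _ \<open>finite X\<close>] by (auto simp: s_def)
  qed (auto simp: s_def list_module_def dec_enc_vec vecs_closed fun_eq_iff)
  have v: "(\<lambda>j. if j < b then f (e j) else 0) \<in> vecs b" for f :: "_ \<Rightarrow> ('n, 'k) mpoly"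
    by (simp add: vecs_def)
  have p: "p \<in> lin_maps poly_ring (free_module poly_ring X) ?L"
    by (rule lin_mapsI)
      (auto simp: p_def list_module_def dec_enc_vec[OF v] v intro!: arg_cong[of _ _ "enc_vec b"])
  have "p (s x) = x" if x: "x \<in> carrier ?L" for x
  proof -
    obtain w where w: "w \<in> vecs b" "x = enc_vec b w" using x by (auto simp: list_module_def)
    have "(\<lambda>j. if j < b then s x (e j) else 0) = w"
      using w by (auto simp: s_def e dec_enc_vec vecs_def)
    then show ?thesis by (simp add: p_def w(2)[symmetric])
  qed
  then show ?thesis
    using s p module_list_module unfolding projective_module_def by blast
qed

text \<open>The maps \<open>e i\<close> and \<open>c i\<close> are mutually inverse isomorphisms;
  conjugating the differentials with them carries kernels and images over. This moves a free
  resolution into the list type.\<close>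

lemma resolution_transport:
  assumes res: "resolution R M F d \<epsilon>" and P: "\<And>i. Module.module R (P i)"
    and e: "\<And>i. e i \<in> lin_maps R (F i) (P i)" and c: "\<And>i. c i \<in> lin_maps R (P i) (F i)"
    and ce: "\<And>i x. x \<in> carrier (F i) \<Longrightarrow> c i (e i x) = x"
    and ec: "\<And>i y. y \<in> carrier (P i) \<Longrightarrow> e i (c i y) = y"
  shows "resolution R M P (\<lambda>i x. e i (d i (c (Suc i) x))) (\<lambda>x. \<epsilon> (c 0 x))"
proof -
  note r = resolutionD[OF res]
  have c_im: "c i ` carrier (P i) = carrier (F i)" for i
    using lin_mapsD(1)[OF c] lin_mapsD(1)[OF e] ce by (auto simp: image_iff) metis
  have zero: "e i \<zero>\<^bsub>F i\<^esub> = \<zero>\<^bsub>P i\<^esub>" "c i \<zero>\<^bsub>P i\<^esub> = \<zero>\<^bsub>F i\<^esub>" for i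
    using lin_maps_zero[OF r(2) P e] lin_maps_zero[OF P r(2) c] by blast+
  have im: "(\<lambda>x. e i (d i (c (Suc i) x))) ` carrier (P (Suc i)) = e i ` d i ` carrier (F (Suc i))" for i
    using c_im[of "Suc i"] by (metis image_image)
  have sub: "e i ` {x \<in> carrier (F i). Q x} = {y \<in> carrier (P i). Q (c i y)}" for i Q
    using lin_mapsD(1)[OF c] lin_mapsD(1)[OF e] ce ec by (auto simp: image_iff) metis
  show ?thesis
    unfolding resolution_def
  proof (intro conjI allI)
    show "(\<lambda>x. \<epsilon> (c 0 x)) ` carrier (P 0) = carrier M"
      using c_im[of 0] r(5) by (metis image_image)
    show "(\<lambda>x. e 0 (d 0 (c (Suc 0) x))) ` carrier (P 1) = {x \<in> carrier (P 0). \<epsilon> (c 0 x) = \<zero>\<^bsub>M\<^esub>}"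
      using im[of 0] by (simp add: r(6) sub)
    have inj: "e i x = \<zero>\<^bsub>P i\<^esub> \<longleftrightarrow> x = \<zero>\<^bsub>F i\<^esub>" if "x \<in> carrier (F i)" for i x
      using ce[OF that] zero by metis
    show "(\<lambda>x. e (Suc i) (d (Suc i) (c (Suc (Suc i)) x))) ` carrier (P (Suc (Suc i))) =
        {x \<in> carrier (P (Suc i)). e i (d i (c (Suc i) x)) = \<zero>\<^bsub>P i\<^esub>}" for i
      unfolding im r(7) sub
      using inj lin_mapsD(1)[OF r(3)] lin_mapsD(1)[OF c] by blast
  qed (use r P in \<open>auto intro!: lin_maps_comp[OF lin_maps_comp[OF c r(3)] e] lin_maps_comp[OF c r(4)]\<close>)
qed

lemma proj_dim_le:
  fixes M :: "(('n, 'k :: field) mpoly, 'm) module"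
  assumes res: "resolution poly_ring M (\<lambda>i. free_module poly_ring {..<b i :: nat}) d \<epsilon>"
    and zero: "\<And>i. l < i \<Longrightarrow> b i = 0"
  shows "proj_dim poly_ring M \<le> enat l"
proof -
  let ?P = "\<lambda>i. list_module (b i) :: (('n, 'k) mpoly, (('n, 'k) mpoly \<times> 'm) list) module"
  have "resolution poly_ring M ?P (\<lambda>i x. enc_vec (b i) (d i (dec_vec x))) (\<lambda>x. \<epsilon> (dec_vec x))"
    using res module_list_module enc_vec_lin dec_vec_lin
  proof (rule resolution_transport)
    fix i and x :: "nat \<Rightarrow> ('n, 'k) mpoly" assume "x \<in> carrier (free_module poly_ring {..<b i})"
    then show "dec_vec (enc_vec (b i) x :: (('n, 'k) mpoly \<times> 'm) list) = x"
      unfolding free_module_vecs by (rule dec_enc_vec)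
  qed (auto simp: list_module_def dec_enc_vec)
  \<comment> \<open>In rank \<open>0\<close> every vector is encoded by the empty list, which is the
    zero of the module.\<close>
  moreover have "carrier (?P i) = {\<zero>\<^bsub>?P i\<^esub>}" if "l < i" for i
    using zero[OF that] by (auto simp: list_module_def enc_vec_def vecs_def)
  ultimately show ?thesis
    unfolding proj_dim_def using projective_list_module by (intro Inf_lower) blast
qed

text \<open>The resolution itself gives the upper bound. A shorter projective resolution would
  vanish in position \<open>l\<close>, which forces \<open>b l = 0\<close> by
  \<open>minimal_resolution_length_le\<close>.\<close>

lemma minimal_resolution_proj_dim:
  fixes M :: "(('n :: finite, 'k :: field) mpoly, 'm) module"
  assumes F: "minimal_graded_free_resolution M H b s d \<epsilon>"
    and l: "b l \<noteq> 0" "\<And>i. l < i \<Longrightarrow> b i = 0"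
  shows "proj_dim poly_ring M = enat l"
proof (rule antisym)
  show "proj_dim poly_ring M \<le> enat l"
    using minimal_graded_free_resolutionD(1)[OF F] l(2) by (rule proj_dim_le)
  show "enat l \<le> proj_dim poly_ring M"
    unfolding proj_dim_def
  proof (rule Inf_greatest, clarify)
    fix k and P :: "nat \<Rightarrow> (('n, 'k) mpoly, (('n, 'k) mpoly \<times> 'm) list) module" and d' \<epsilon>'
    assume P: "resolution poly_ring M P d' \<epsilon>'" "\<forall>i. projective_module poly_ring (P i)"
      "\<forall>i>k. carrier (P i) = {\<zero>\<^bsub>P i\<^esub>}"
    show "enat l \<le> enat k"
    proof (rule ccontr)
      assume "\<not> ?thesis"
      then have "carrier (P l) = {\<zero>\<^bsub>P l\<^esub>}" using P(3) by simp
      then have "b l = 0" using minimal_resolution_length_le[OF F P(1)] P(2) by blast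
      then show False using l(1) by simp
    qed
  qed
qed

text \<open>The zero ideal has no generators over which to take a maximum, so the projective
  dimension is claimed when at least one generator exists.\<close>

theorem mainTheorem5:
  fixes a :: "'n :: {finite, linorder} \<Rightarrow>\<^sub>0 nat"
    and I :: "('n, 'k :: field) mpoly set"
    and d :: nat
  assumes "monomial_ideal I"
    and "determined_by a I"
    and "strongly_stable I"
    and "generated_in_degree d I"
  shows "(\<forall>i. ideal_betti (dual_ideal a I) i = (\<Sum>f\<in>min_gens I. card (supp1 f) choose i)) \<and>
    (min_gens I \<noteq> {} \<longrightarrow>
      proj_dim poly_ring (ideal_module (dual_ideal a I)) =
        enat (Max ((\<lambda>f. card (supp1 f)) ` min_gens I)))"
proof -
  let ?b = "\<lambda>i. \<Sum>f\<in>min_gens I. card (supp1 f) choose i"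
  let ?L = "Max ((\<lambda>f. card (supp1 f)) ` min_gens I)"
  have fin: "finite (min_gens I)" using assms by (rule finite_min_gens)
  have "ideal (dual_ideal a I) poly_ring"
    unfolding dual_ideal_def Idl_xpow by (rule ideal_monomial_span)
  \<comment> \<open>Reading the ranks from position \<open>1\<close> on turns the resolution of the
    quotient into one of the ideal, with the claimed sums as ranks.\<close>
  then obtain d' \<epsilon> where res: "minimal_graded_free_resolution (ideal_module (dual_ideal a I))
      (\<lambda>t. dual_ideal a I \<inter> homogeneous_of t) ?b
      (\<lambda>i j. int (mon_deg a) - int d + int i) d' \<epsilon>"
    using lin_res_dual_ideal[OF assms] lin_res_minimal_resolution[of "dual_ideal a I"] by fastforce
  have "proj_dim poly_ring (ideal_module (dual_ideal a I)) = enat ?L" if "min_gens I \<noteq> {}"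
  proof (rule minimal_resolution_proj_dim[OF res])
    \<comment> \<open>The maximum is attained by some generator, whose summand in position
      \<open>?L\<close> is \<open>?L choose ?L\<close>, that is, one.\<close>
    have "?L \<in> (\<lambda>f. card (supp1 f)) ` min_gens I" using fin that by (intro Max_in) auto
    then obtain f where "f \<in> min_gens I" "card (supp1 f) = ?L" by force
    then have "\<exists>f\<in>min_gens I. card (supp1 f) choose ?L \<noteq> 0" by (intro bexI[of _ f]) simp_all
    then show "?b ?L \<noteq> 0" using fin by simp
    \<comment> \<open>Beyond the maximum every binomial coefficient in the sum vanishes.\<close>
    fix i assume "?L < i"
    then have "card (supp1 f) < i" if "f \<in> min_gens I" for f
      using fin that by (meson Max_ge finite_imageI image_eqI le_less_trans)
    then show "?b i = 0" by (intro sum.neutral ballI binomial_eq_0)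
  qed
  then show ?thesis
    using betti_eqI[OF res] unfolding ideal_betti_def by blast
qed

end
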